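(* Let $G$ be a simple undirected connected graph on $\{1,\dots,N\}$ with adjacency matrix $A=[a_{\ell k}]$. Assume $c>0$, $\omega_\ell=\omega\in\mathbb R$ for all $\ell\in\{1,\dots,N\}$, and $$\mu>c\,d_{\max}:=c\max_{1\le\ell\le N}\left(\sum_{k=1}^N a_{\ell k}\right),$$ where $\mu>0$. Let $z=(z_1,\dots,z_N)$ be a solution of $$\dot z_\ell=(\mu+\mathrm i\omega)z_\ell-|z_\ell|^2z_\ell+c\sum_{k=1}^N a_{\ell k}(z_k-z_\ell),\qquad \ell=1,\dots,N,$$ whose initial data $z_\ell(0)=r_\ell(0)e^{\mathrm i\theta_\ell(0)}$ satisfy $$r_\ell(0)>0,\qquad 0<\theta_\ell(0)<\frac{\pi}{2},\qquad \ell=1,\dots,N.$$ Then the solution exists globally for $t\ge0$ and the network achieves complete synchronization. More precisely, there exists $\vartheta^\ast\in(0,\frac{\pi}{2})$ such that for all $\ell,k\in\{1,\dots,N\}$ $$\lim_{t\to\infty}r_\ell(t)=\sqrt\mu,\quad \lim_{t\to\infty}|\dot r_\ell(t)-\dot r_k(t)|=0,\quad \lim_{t\to\infty}|\dot\theta_\ell(t)-\dot\theta_k(t)|=0,\quad \lim_{t\to\infty}\operatorname{dist}_{\mathbb S^1}(\theta_\ell(t)-\omega t,\vartheta^\ast)=0.$$ Equivalently, $\lim_{t\to\infty}\left|z_\ell(t)-\sqrt\mu\,e^{\mathrm i(\omega t+\vartheta^\ast)}\right|=0$ for $\ell=1,\dots,N$. Moreover, for all $\ell,k\in\{1,\dots,N\}$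 the convergences $r_\ell(t)\to\sqrt\mu$, $|\dot r_\ell(t)-\dot r_k(t)|\to0$, $|\dot\theta_\ell(t)-\dot\theta_k(t)|\to0$, $\operatorname{dist}_{\mathbb S^1}(\theta_\ell(t)-\omega t,\vartheta^\ast)\to0$ and $\left|z_\ell(t)-\sqrt\mu\,e^{\mathrm i(\omega t+\vartheta^\ast)}\right|\to0$ as $t\to\infty$ all occur at an exponential rate; hence the network attains exponential complete synchronization.
   Context: Graph conventions: $a_{\ell k}\in\{0,1\}$, $a_{\ell\ell}=0$, $a_{\ell k}=a_{k\ell}$. Polar coordinates: $r_\ell(t)=|z_\ell(t)|$, and on any time interval where $r_\ell>0$, $\theta_\ell$ is an unwrapped angle, i.e. a continuous real-valued function with $z_\ell(t)=r_\ell(t)e^{\mathrm i\theta_\ell(t)}$ (with the given value $\theta_\ell(0)$). The circular distance is $\operatorname{dist}_{\mathbb S^1}(\alpha,\beta)=\min_{m\in\mathbb Z}|\alpha-\beta+2\pi m|\in[0,\pi]$. Complete synchronization of a solution (defined when $r_\ell(t)>0$ for all $t\ge0$ and all $\ell$, so that the phases are globally defined) means that for all $\ell,k$, as $t\to\infty$: $|r_\ell-r_k|\to0$, $|\dot r_\ell-\dot r_k|\to0$, $|\dot\theta_\ell-\dot\theta_k|\to0$ and $\operatorname{dist}_{\mathbb S^1}(\theta_\ell,\theta_k)\to0$. It is exponential if these convergences are exponential. A quantity $q(t)$ converges to $q_\infty$ at an exponential rate if there exist constants $C,\gamma>0$ such that the distance from $q(t)$ to $q_\infty$ is at most $Ce^{-\gamma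 t}$ for all $t\ge0$. *)

theory Defs
  imports "HOL-Analysis.Analysis" "Graph_Theory.Digraph_Component"
begin

text \<open>
  Networks are indexed by a finite type \<open>'n\<close> in place of \<open>{1..N}\<close>.  A simple undirected graph is a
  \<^const>\<open>pair_graph\<close>: a finite loop-free digraph without parallel arcs whose arc set is symmetric.
\<close>

definition adj :: "'n pair_pre_digraph \<Rightarrow> 'n \<Rightarrow> 'n \<Rightarrow> real" where
  "adj G l k = (if (l, k) \<in> parcs G then 1 else 0)"

definition network_field ::
    "'n::finite pair_pre_digraph \<Rightarrow> real \<Rightarrow> real \<Rightarrow> real \<Rightarrow> complex ^ 'n \<Rightarrow> complex ^ 'n" where
  "network_field G \<mu> \<omega> c w =
     (\<chi> l. (of_real \<mu> + \<i> * of_real \<omega>) * w $ l - of_real ((cmod (w $ l))\<^sup>2) * w $ l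
           + of_real c * (\<Sum>k\<in>UNIV. of_real (adj G l k) * (w $ k - w $ l)))"

text \<open>On a time interval \<open>J\<close>; derivatives at endpoints belonging to \<open>J\<close> are one-sided.\<close>

definition network_solution ::
    "'n::finite pair_pre_digraph \<Rightarrow> real \<Rightarrow> real \<Rightarrow> real \<Rightarrow> real set \<Rightarrow> (real \<Rightarrow> complex ^ 'n) \<Rightarrow> bool"
  where
  "network_solution G \<mu> \<omega> c J z \<longleftrightarrow>
     (\<forall>t\<in>J. (z has_vector_derivative network_field G \<mu> \<omega> c (z t)) (at t within J))"

abbreviation radius :: "(real \<Rightarrow> complex ^ 'n) \<Rightarrow> 'n \<Rightarrow> real \<Rightarrow> real" where
  "radius z l t \<equiv> cmod (z t $ l)"

definition unwrapped_angle :: "(real \<Rightarrow> complex) \<Rightarrow> (real \<Rightarrow> real) \<Rightarrow> bool" where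
  "unwrapped_angle w \<theta> \<longleftrightarrow>
     continuous_on {0..} \<theta> \<and> (\<forall>t\<ge>0. w t = of_real (cmod (w t)) * exp (\<i> * of_real (\<theta> t)))"

text \<open>The infimum is attained, hence a minimum: only finitely many of the terms lie below any bound.\<close>

definition dist_S1 :: "real \<Rightarrow> real \<Rightarrow> real" where
  "dist_S1 \<alpha> \<beta> = (INF m::int. \<bar>\<alpha> - \<beta> + 2 * pi * of_int m\<bar>)"

text \<open>The derivative of a function on \<open>[0, \<infinity>)\<close>, one-sided at \<open>0\<close>.\<close>

definition time_deriv :: "(real \<Rightarrow> real) \<Rightarrow> real \<Rightarrow> real" where
  "time_deriv f t = vector_derivative f (at t within {0..})"

definition exp_tendsto :: "(real \<Rightarrow> 'a::metric_space) \<Rightarrow> 'a \<Rightarrow> bool" where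
  "exp_tendsto q L \<longleftrightarrow> (\<exists>C>0. \<exists>\<gamma>>0. \<forall>t\<ge>0. dist (q t) L \<le> C * exp (- \<gamma> * t))"

text \<open>
  \<open>polar_phases z \<theta>\<close>: all moduli of \<open>z\<close> stay positive, \<open>\<theta>\<close> collects the (then globally defined) unwrapped
  angles, and the polar coordinates are differentiable, so that \<^const>\<open>time_deriv\<close> is meaningful for them.
\<close>

definition polar_phases :: "(real \<Rightarrow> complex ^ 'n) \<Rightarrow> ('n \<Rightarrow> real \<Rightarrow> real) \<Rightarrow> bool" where
  "polar_phases z \<theta> \<longleftrightarrow>
     (\<forall>l. (\<forall>t\<ge>0. radius z l t > 0) \<and> unwrapped_angle (\<lambda>t. z t $ l) (\<theta> l)
        \<and> radius z l differentiable_on {0..} \<and> \<theta> l differentiable_on {0..})"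

definition complete_sync :: "(real \<Rightarrow> complex ^ 'n) \<Rightarrow> ('n \<Rightarrow> real \<Rightarrow> real) \<Rightarrow> bool" where
  "complete_sync z \<theta> \<longleftrightarrow> polar_phases z \<theta> \<and>
     (\<forall>l k. ((\<lambda>t. \<bar>radius z l t - radius z k t\<bar>) \<longlongrightarrow> 0) at_top
          \<and> ((\<lambda>t. \<bar>time_deriv (radius z l) t - time_deriv (radius z k) t\<bar>) \<longlongrightarrow> 0) at_top
          \<and> ((\<lambda>t. \<bar>time_deriv (\<theta> l) t - time_deriv (\<theta> k) t\<bar>) \<longlongrightarrow> 0) at_top
          \<and> ((\<lambda>t. dist_S1 (\<theta> l t) (\<theta> k t)) \<longlongrightarrow> 0) at_top)"

definition exp_complete_sync :: "(real \<Rightarrow> complex ^ 'n) \<Rightarrow> ('n \<Rightarrow> real \<Rightarrow> real) \<Rightarrow> bool" where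
  "exp_complete_sync z \<theta> \<longleftrightarrow> polar_phases z \<theta> \<and>
     (\<forall>l k. exp_tendsto (\<lambda>t. \<bar>radius z l t - radius z k t\<bar>) 0
          \<and> exp_tendsto (\<lambda>t. \<bar>time_deriv (radius z l) t - time_deriv (radius z k) t\<bar>) 0
          \<and> exp_tendsto (\<lambda>t. \<bar>time_deriv (\<theta> l) t - time_deriv (\<theta> k) t\<bar>) 0
          \<and> exp_tendsto (\<lambda>t. dist_S1 (\<theta> l t) (\<theta> k t)) 0)"

end

theory Submission
  imports Defs "HOL-Real_Asymp.Real_Asymp"
begin

text \<open>
  In the frame rotating with the common frequency the system is
  \<open>u\<^sub>l' = (\<mu> - |u\<^sub>l|\<^sup>2) u\<^sub>l + c \<Sum>\<^sub>k a\<^sub>l\<^sub>k (u\<^sub>k - u\<^sub>l)\<close>. It is the gradient flow of an energy whose minimisers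
  are the synchronized states \<open>u\<^sub>1 = \<dots> = u\<^sub>N\<close> of modulus \<open>sqrt \<mu>\<close>. Such a flow converges exponentially as
  soon as the trajectory stays where the energy is bounded by a multiple of its dissipation, the squared
  norm of the gradient.

  That region comes from the sign structure. The coefficients are real, so each real linear functional of
  the components, such as \<open>Re u\<^sub>l\<close>, \<open>Im u\<^sub>l\<close>, or \<open>Q Re u\<^sub>l - Im u\<^sub>l\<close>, satisfies one and the same cooperative
  linear system. A maximum principle (\<open>network_maximum_principle\<close>) therefore keeps all \<open>u\<^sub>l\<close> in a closed
  sector that contains the initial data and meets the boundary of the quadrant only at \<open>0\<close>.
  In that sector \<open>|u\<^sub>l|\<close> is comparable to \<open>Re u\<^sub>l\<close>, and the same principle bounds \<open>|u\<^sub>l|\<close> from above and \<open>Re u\<^sub>l\<close> away from zero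
  (\<open>global_solution_in_cone\<close>).

  In this region the gradient controls the distance to the synchronized states
  (\<open>distance_to_equilibrium_bound\<close>). The slopes \<open>q\<^sub>l = Im u\<^sub>l / Re u\<^sub>l\<close> satisfy a weighted Laplace equation whose
  right-hand side is a component of the gradient; testing with \<open>q\<^sub>l - q\<^sub>j\<close> and the Poincare inequality of
  the connected graph bound the differences of slopes. When the slopes nearly agree, the radial equation is
  coercive, and this bounds the distance of \<open>Re u\<^sub>l\<close> to its equilibrium value. Hence energy and dissipation
  decay exponentially, the velocity is exponentially small, and each component has the same limit \<open>v\<close>
  (\<open>exponential_convergence\<close>). The limiting phase is the argument of \<open>v\<close>, and all claims on polar
  coordinates follow because \<open>Ln u\<^sub>l\<close> has derivative \<open>u\<^sub>l' / u\<^sub>l\<close>.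

  Existence is obtained by truncating the cubic term at a level that the solution never exceeds; the
  truncated field is globally Lipschitz. Uniqueness follows from a one-sided Lipschitz bound for the field:
  both the cubic damping and the coupling are dissipative.
\<close>

section \<open>Differential inequalities\<close>

text \<open>
  The sign of \<open>K\<close> is arbitrary: the lemma serves both for uniqueness and for exponential decay. One-sided
  derivatives at the ends of the interval suffice.
\<close>

lemma gronwall_differential:
  fixes f f' :: "real \<Rightarrow> real"
  assumes "0 \<le> t"
    and deriv: "\<And>s. s \<in> {0..t} \<Longrightarrow> (f has_real_derivative f' s) (at s within {0..t})"
    and le: "\<And>s. s \<in> {0..t} \<Longrightarrow> f' s \<le> K * f s"
  shows "f t \<le> f 0 * exp (K * t)"
proof -
  define g where "g s = f s * exp (- K * s)" for s
  have dg: "(g has_real_derivative (f' s - K * f s) * exp (- K * s)) (at s within {0..t})"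
    if "s \<in> {0..t}" for s
    unfolding g_def
    by (rule derivative_eq_intros deriv[OF that] refl | simp add: algebra_simps)+
  have "g t \<le> g 0"
  proof (rule DERIV_nonpos_imp_decreasing_open[OF \<open>0 \<le> t\<close>])
    fix s assume s: "0 < s" "s < t"
    then have "(g has_real_derivative (f' s - K * f s) * exp (- K * s)) (at s)"
      using dg[of s] by (simp add: at_within_Icc_at)
    moreover have "(f' s - K * f s) * exp (- K * s) \<le> 0"
      using le[of s] s by (simp add: mult_nonpos_nonneg)
    ultimately show "\<exists>y. (g has_real_derivative y) (at s) \<and> y \<le> 0" by blast
  next
    show "continuous_on {0..t} g"
      using dg DERIV_continuous continuous_on_eq_continuous_within by blast
  qed
  then show ?thesis
    by (simp add: g_def exp_minus field_simps)
qed

text \<open>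
  Squaring removes the corner of the positive part, so that sums of squared positive parts are admissible
  in Gronwall arguments.
\<close>

lemma has_real_derivative_positive_part_square:
  "((\<lambda>x. (max 0 x)\<^sup>2) has_real_derivative 2 * max 0 x) (at x)"
proof -
  \<comment> \<open>a quadratic remainder, uniformly in the four sign patterns\<close>
  have bound: "\<bar>(max 0 y)\<^sup>2 - (max 0 x)\<^sup>2 - 2 * max 0 x * (y - x)\<bar> \<le> (y - x)\<^sup>2" for y :: real
  proof -
    consider "0 \<le> x" "0 \<le> y" | "0 \<le> x" "y < 0" | "x < 0" "0 \<le> y" | "x < 0" "y < 0" by linarith
    then show ?thesis
    proof cases
      case 1
      then have "(max 0 y)\<^sup>2 - (max 0 x)\<^sup>2 - 2 * max 0 x * (y - x) = (y - x)\<^sup>2"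
        by (simp add: power2_eq_square algebra_simps)
      then show ?thesis by simp
    next
      case 2
      have "(max 0 y)\<^sup>2 - (max 0 x)\<^sup>2 - 2 * max 0 x * (y - x) = x * (x - 2 * y)"
        using 2 by (simp add: power2_eq_square algebra_simps)
      moreover have "0 \<le> x * (x - 2 * y)" using 2 by simp
      moreover have "x * (x - 2 * y) \<le> (y - x)\<^sup>2" by (simp add: power2_eq_square algebra_simps)
      ultimately show ?thesis by simp
    next
      case 3
      have "y\<^sup>2 \<le> (y - x)\<^sup>2" using 3 by (intro power_mono) auto
      then show ?thesis using 3 by simp
    next
      case 4
      then show ?thesis by simp
    qed
  qed
  have "((\<lambda>y. ((max 0 y)\<^sup>2 - (max 0 x)\<^sup>2) / (y - x) - 2 * max 0 x) \<longlongrightarrow> 0) (at x)"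
  proof (rule Lim_null_comparison)
    show "\<forall>\<^sub>F y in at x. norm (((max 0 y)\<^sup>2 - (max 0 x)\<^sup>2) / (y - x) - 2 * max 0 x) \<le> \<bar>y - x\<bar>"
      unfolding eventually_at_filter
    proof (rule always_eventually, intro allI impI)
      fix y :: real assume "y \<noteq> x"
      then have "((max 0 y)\<^sup>2 - (max 0 x)\<^sup>2) / (y - x) - 2 * max 0 x
          = ((max 0 y)\<^sup>2 - (max 0 x)\<^sup>2 - 2 * max 0 x * (y - x)) / (y - x)"
        by (simp add: field_simps)
      then have "norm (((max 0 y)\<^sup>2 - (max 0 x)\<^sup>2) / (y - x) - 2 * max 0 x) \<le> (y - x)\<^sup>2 / \<bar>y - x\<bar>"
        using bound[of y] by (simp add: abs_divide divide_right_mono)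
      also have "\<dots> = \<bar>y - x\<bar>"
        using \<open>y \<noteq> x\<close> by (metis abs_zero divide_eq_eq abs_eq_0 power2_abs power2_eq_square right_minus_eq)
      finally show "norm (((max 0 y)\<^sup>2 - (max 0 x)\<^sup>2) / (y - x) - 2 * max 0 x) \<le> \<bar>y - x\<bar>" .
    qed
    show "((\<lambda>y. \<bar>y - x\<bar>) \<longlongrightarrow> 0) (at x)"
      by (rule tendsto_eq_intros refl | simp)+
  qed
  then show ?thesis
    by (simp add: has_field_derivative_iff LIM_zero_iff)
qed

lemma positive_part_square_deriv:
  assumes "(f has_real_derivative f') (at t within S)"
  shows "((\<lambda>t. (max 0 (f t))\<^sup>2) has_real_derivative 2 * max 0 (f t) * f') (at t within S)"
  using DERIV_chain2[OF has_real_derivative_positive_part_square assms] .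

lemma norm_square_has_real_derivative:
  fixes f :: "real \<Rightarrow> 'a::real_inner"
  assumes "(f has_vector_derivative f') (at t within S)"
  shows "((\<lambda>t. (norm (f t))\<^sup>2) has_real_derivative 2 * (f t \<bullet> f')) (at t within S)"
proof -
  have "((\<lambda>t. f t \<bullet> f t) has_derivative (\<lambda>h. f t \<bullet> (h *\<^sub>R f') + (h *\<^sub>R f') \<bullet> f t)) (at t within S)"
    using assms unfolding has_vector_derivative_def by (intro has_derivative_inner)
  moreover have "(\<lambda>h. f t \<bullet> (h *\<^sub>R f') + (h *\<^sub>R f') \<bullet> f t) = (*) (2 * (f t \<bullet> f'))"
    by (simp add: fun_eq_iff inner_commute)
  ultimately show ?thesis
    unfolding has_field_derivative_def power2_norm_eq_inner by simp
qed

section \<open>Flows of globally Lipschitz vector fields\<close>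

text \<open>
  In the norm weighted by \<open>exp (- 2 L t)\<close> the Picard operator contracts by the factor \<open>1/2\<close> on the whole
  half-line, so a single application of the Banach fixed point theorem yields the global solution, without
  any patching of local ones. The weight is absorbed into the unknown: the operator acts on the bounded
  function \<open>exp (- 2 L t) u(t)\<close>, extended to negative times by its value at \<open>0\<close>.
\<close>

theorem global_solution_of_Lipschitz_field:
  fixes F :: "'a::banach \<Rightarrow> 'a"
  assumes lip: "\<And>v w. norm (F v - F w) \<le> L * norm (v - w)" and "L > 0"
  shows "\<exists>u. u 0 = u\<^sub>0 \<and> (\<forall>t\<ge>0. (u has_vector_derivative F (u t)) (at t within {0..}))"
proof -
  define K where "K = 2 * L"
  have K: "K > 0" using \<open>L > 0\<close> by (simp add: K_def)
  have contF: "continuous_on UNIV F"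
    by (rule lipschitz_on_continuous_on[of L])
      (use lip \<open>L > 0\<close> in \<open>auto simp: lipschitz_on_def dist_norm\<close>)
  define I where "I v t = u\<^sub>0 + integral {0..t} (\<lambda>s. F (exp (K * s) *\<^sub>R v s))" for v :: "real \<Rightarrow> 'a" and t
  define T where "T v t = exp (- K * max 0 t) *\<^sub>R I v (max 0 t)" for v :: "real \<Rightarrow> 'a" and t
  have contI: "continuous_on S (\<lambda>s. F (exp (K * s) *\<^sub>R v s))" if "continuous_on UNIV v" for v S
  proof -
    have "continuous_on UNIV (\<lambda>s. exp (K * s) *\<^sub>R v s)"
      by (intro continuous_intros that)
    from continuous_on_compose2[OF contF this] show ?thesis
      using continuous_on_subset by blast
  qed
  have expint: "integral {0..t} (\<lambda>s. exp (K * s)) = (exp (K * t) - 1) / K" if "0 \<le> t" for t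
  proof -
    have "((\<lambda>s. exp (K * s)) has_integral exp (K * t) / K - exp (K * 0) / K) {0..t}"
      using K by (intro fundamental_theorem_of_calculus that)
        (auto simp: has_real_derivative_iff_has_vector_derivative[symmetric]
              intro!: derivative_eq_intros)
    then show ?thesis by (simp add: integral_unique diff_divide_distrib)
  qed
  have diff: "norm (T v t - T w t) \<le> 1/2 * e"
    if cv: "continuous_on UNIV v" "continuous_on UNIV w" and e: "\<And>s. norm (v s - w s) \<le> e" for v w t e
  proof -
    define \<tau> where "\<tau> = max 0 t"
    have \<tau>: "0 \<le> \<tau>" by (simp add: \<tau>_def)
    have e0: "0 \<le> e" using e[of 0] norm_ge_zero order_trans by blast
    have "norm (I v \<tau> - I w \<tau>)
        = norm (integral {0..\<tau>} (\<lambda>s. F (exp (K * s) *\<^sub>R v s) - F (exp (K * s) *\<^sub>R w s)))"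
      unfolding I_def
      by (subst integral_diff) (auto intro!: integrable_continuous_real contI cv)
    also have "\<dots> \<le> integral {0..\<tau>} (\<lambda>s. L * e * exp (K * s))"
    proof (rule integral_norm_bound_integral)
      fix s
      have "norm (F (exp (K * s) *\<^sub>R v s) - F (exp (K * s) *\<^sub>R w s))
          \<le> L * (exp (K * s) * norm (v s - w s))"
        using lip[of "exp (K * s) *\<^sub>R v s" "exp (K * s) *\<^sub>R w s"]
        by (simp add: scaleR_diff_right[symmetric])
      also have "\<dots> \<le> L * (exp (K * s) * e)"
        using e[of s] \<open>L > 0\<close> by (intro mult_left_mono) auto
      finally show "norm (F (exp (K * s) *\<^sub>R v s) - F (exp (K * s) *\<^sub>R w s)) \<le> L * e * exp (K * s)"
        by (simp add: mult_ac)
    qed (auto intro!: integrable_continuous_real continuous_intros contI cv)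
    also have "\<dots> = L * e * ((exp (K * \<tau>) - 1) / K)"
      by (simp add: expint[OF \<tau>])
    also have "\<dots> \<le> 1/2 * e * exp (K * \<tau>)"
      using \<open>L > 0\<close> e0 by (simp add: K_def field_simps)
    finally have *: "norm (I v \<tau> - I w \<tau>) \<le> 1/2 * e * exp (K * \<tau>)" .
    have "norm (T v t - T w t) = exp (- K * \<tau>) * norm (I v \<tau> - I w \<tau>)"
      by (simp add: T_def \<tau>_def scaleR_diff_right[symmetric])
    also have "\<dots> \<le> exp (- K * \<tau>) * (1/2 * e * exp (K * \<tau>))"
      by (rule mult_left_mono[OF *]) simp
    also have "\<dots> = 1/2 * e" by (simp add: exp_minus)
    finally show ?thesis .
  qed
  have dI: "(I v has_vector_derivative F (exp (K * t) *\<^sub>R v t)) (at t within {0..})"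
    if cv: "continuous_on UNIV v" and t: "0 \<le> t" for v t
  proof -
    have "((\<lambda>t. integral {0..t} (\<lambda>s. F (exp (K * s) *\<^sub>R v s))) has_vector_derivative
        F (exp (K * t) *\<^sub>R v t)) (at t within {0..t+1})"
      using t by (intro integral_has_vector_derivative contI cv) auto
    then have "(I v has_vector_derivative F (exp (K * t) *\<^sub>R v t)) (at t within {0..t+1})"
      unfolding I_def by (auto intro!: derivative_eq_intros)
    moreover have "at t within {0..t+1} = at t within {0..}"
      by (rule at_within_nhd[of t "{..<t+1}"]) auto
    ultimately show ?thesis by simp
  qed
  have contT: "continuous_on UNIV (T v)" if "continuous_on UNIV v" for v
  proof -
    have "continuous_on {0..} (I v)"
      using dI[OF that] has_vector_derivative_continuous
      by (fastforce simp: continuous_on_eq_continuous_within)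
    then have "continuous_on UNIV (\<lambda>t. I v (max 0 t))"
      by (rule continuous_on_compose2) (auto intro!: continuous_intros)
    then show ?thesis
      unfolding T_def by (intro continuous_intros)
  qed
  have bound0: "norm (T (\<lambda>_. 0) t) \<le> norm u\<^sub>0 + norm (F 0) / K" for t
  proof -
    define \<tau> where "\<tau> = max 0 t"
    have \<tau>: "0 \<le> \<tau>" by (simp add: \<tau>_def)
    have "norm (T (\<lambda>_. 0) t) = exp (- K * \<tau>) * norm (u\<^sub>0 + \<tau> *\<^sub>R F 0)"
      using \<tau> by (simp add: T_def I_def \<tau>_def[symmetric])
    also have "\<dots> \<le> exp (- K * \<tau>) * (norm u\<^sub>0 + \<tau> * norm (F 0))"
      using \<tau> norm_triangle_ineq[of u\<^sub>0 "\<tau> *\<^sub>R F 0"] by (intro mult_left_mono) auto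
    also have "\<dots> = exp (- K * \<tau>) * norm u\<^sub>0 + (exp (- K * \<tau>) * \<tau>) * norm (F 0)"
      by (simp add: algebra_simps)
    also have "\<dots> \<le> 1 * norm u\<^sub>0 + (1 / K) * norm (F 0)"
    proof (intro add_mono mult_right_mono)
      have "K * \<tau> \<le> exp (K * \<tau>)" using exp_ge_add_one_self[of "K * \<tau>"] by linarith
      then show "exp (- K * \<tau>) * \<tau> \<le> 1 / K"
        using K by (simp add: exp_minus field_simps)
    qed (use K \<tau> in auto)
    finally show ?thesis by simp
  qed
  define B where "B v = Bcontfun (T (apply_bcontfun v))" for v
  have B: "apply_bcontfun (B v) t = T v t" for v t
  proof -
    have "norm (T v t) \<le> norm u\<^sub>0 + norm (F 0) / K + 1/2 * norm v" for t
    proof -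
      have "norm (T v t - T (\<lambda>_. 0) t) \<le> 1/2 * norm v"
        by (rule diff) (auto simp: norm_bounded)
      then show ?thesis
        using bound0[of t] norm_triangle_sub[of "T v t" "T (\<lambda>_. 0) t"] by linarith
    qed
    then have "T (apply_bcontfun v) \<in> bcontfun"
      by (intro bcontfun_normI[OF contT]) auto
    then show ?thesis by (simp add: B_def Bcontfun_inverse)
  qed
  have "\<exists>!v. B v = v"
  proof (rule banach_fix_type[of "1/2"]; (intro allI)?)
    fix v w
    show "dist (B v) (B w) \<le> 1/2 * dist v w"
    proof (rule dist_bound)
      fix t
      show "dist (apply_bcontfun (B v) t) (apply_bcontfun (B w) t) \<le> 1/2 * dist v w"
        unfolding dist_norm B
        by (rule diff) (use norm_bounded[of "v - w"] in auto)
    qed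
  qed auto
  then obtain v where "B v = v" by blast
  then have v: "apply_bcontfun v t = T v t" for t using B by metis
  have fixpoint: "exp (K * t) *\<^sub>R apply_bcontfun v t = I v t" if "0 \<le> t" for t
    by (subst v) (use that in \<open>simp add: T_def exp_minus\<close>)
  show ?thesis
  proof (intro exI[of _ "I v"] conjI allI impI)
    show "I v 0 = u\<^sub>0" by (simp add: I_def)
    show "(I v has_vector_derivative F (I v t)) (at t within {0..})" if "0 \<le> t" for t
      using dI[of "apply_bcontfun v" t] that by (simp add: fixpoint)
  qed
qed

section \<open>Symmetric weights on a finite vertex set\<close>

locale symmetric_weights =
  fixes a :: "'n::finite \<Rightarrow> 'n \<Rightarrow> real"
  assumes sym: "a l k = a k l"
    and nonneg: "0 \<le> a l k"
begin

text \<open>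
  Exchange the two summation indices and average.
\<close>

lemma summation_by_parts:
  fixes b p :: "'n \<Rightarrow> 'v::real_inner"
  shows "(\<Sum>l\<in>UNIV. \<Sum>k\<in>UNIV. a l k * (b l \<bullet> (p k - p l)))
       = - (\<Sum>l\<in>UNIV. \<Sum>k\<in>UNIV. a l k * ((b k - b l) \<bullet> (p k - p l))) / 2"
proof -
  define S where "S = (\<Sum>l\<in>UNIV. \<Sum>k\<in>UNIV. a l k * (b l \<bullet> (p k - p l)))"
  have "S = (\<Sum>l\<in>UNIV. \<Sum>k\<in>UNIV. a k l * (b k \<bullet> (p l - p k)))"
    unfolding S_def by (rule sum.swap)
  also have "\<dots> = (\<Sum>l\<in>UNIV. \<Sum>k\<in>UNIV. - (a l k * (b k \<bullet> (p k - p l))))"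
    by (intro sum.cong refl, subst sym) (simp add: inner_diff_right algebra_simps)
  finally have S: "S = (\<Sum>l\<in>UNIV. \<Sum>k\<in>UNIV. - (a l k * (b k \<bullet> (p k - p l))))" .
  have "S + S = (\<Sum>l\<in>UNIV. \<Sum>k\<in>UNIV. a l k * (b l \<bullet> (p k - p l)) - a l k * (b k \<bullet> (p k - p l)))"
    by (subst (2) S) (simp add: S_def sum_subtractf sum_negf)
  also have "\<dots> = - (\<Sum>l\<in>UNIV. \<Sum>k\<in>UNIV. a l k * ((b k - b l) \<bullet> (p k - p l)))"
    by (simp add: sum_negf[symmetric] inner_diff_left algebra_simps)
  finally show ?thesis by (simp add: S_def)
qed

definition dirichlet_form :: "('n \<Rightarrow> 'v::real_inner) \<Rightarrow> real" where
  "dirichlet_form p = (\<Sum>l\<in>UNIV. \<Sum>k\<in>UNIV. a l k * (norm (p k - p l))\<^sup>2)"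

lemma dirichlet_form_nonneg: "0 \<le> dirichlet_form p"
  unfolding dirichlet_form_def by (intro sum_nonneg mult_nonneg_nonneg nonneg) auto

lemma sum_inner_differences:
  fixes p :: "'n \<Rightarrow> 'v::real_inner"
  shows "(\<Sum>l\<in>UNIV. \<Sum>k\<in>UNIV. a l k * ((p l - p\<^sub>0) \<bullet> (p k - p l))) = - dirichlet_form p / 2"
  using summation_by_parts[of "\<lambda>l. p l - p\<^sub>0" p]
  by (simp add: dirichlet_form_def power2_norm_eq_inner)

text \<open>
  The sum of the squared positive parts of the \<open>w\<^sub>l\<close> satisfies a Gronwall inequality: the coupling
  contributes a nonpositive amount because, after summation by parts, the increments of \<open>w\<close> and of its
  positive part have the same sign on every edge. The differential inequality is required only where \<open>w\<^sub>l\<close>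
  is positive, which lets nonlinear terms be estimated by their sign there.
\<close>

lemma network_maximum_principle:
  fixes w w' :: "'n \<Rightarrow> real \<Rightarrow> real"
  assumes deriv: "\<And>l t. 0 \<le> t \<Longrightarrow> (w l has_real_derivative w' l t) (at t within {0..})"
    and le: "\<And>l t. 0 \<le> t \<Longrightarrow> 0 < w l t \<Longrightarrow>
      w' l t \<le> K * w l t + c * (\<Sum>k\<in>UNIV. a l k * (w k t - w l t))"
    and "0 \<le> c" and init: "\<And>l. w l 0 \<le> 0" and "0 \<le> t"
  shows "w l t \<le> 0"
proof -
  define p where "p l t = max 0 (w l t)" for l t
  define \<Phi> where "\<Phi> t = (\<Sum>l\<in>UNIV. (p l t)\<^sup>2)" for t
  have "\<Phi> t \<le> \<Phi> 0 * exp (2 * K * t)"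
  proof (rule gronwall_differential[OF \<open>0 \<le> t\<close>])
    fix s assume "s \<in> {0..t}"
    then have s: "0 \<le> s" by simp
    have "(\<Phi> has_real_derivative (\<Sum>l\<in>UNIV. 2 * p l s * w' l s)) (at s within {0..})"
      unfolding \<Phi>_def p_def
      by (intro DERIV_sum positive_part_square_deriv deriv s)
    then show "(\<Phi> has_real_derivative (\<Sum>l\<in>UNIV. 2 * p l s * w' l s)) (at s within {0..t})"
      by (rule has_field_derivative_subset) auto
    have "p l s * w' l s \<le> K * (p l s)\<^sup>2 + c * (\<Sum>k\<in>UNIV. a l k * (p l s \<bullet> (w k s - w l s)))" for l
    proof (cases "0 < w l s")
      case True
      then have "p l s * w' l s \<le> p l s * (K * w l s + c * (\<Sum>k\<in>UNIV. a l k * (w k s - w l s)))"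
        by (intro mult_left_mono le s) (auto simp: p_def)
      also have "\<dots> = K * (p l s)\<^sup>2 + c * (\<Sum>k\<in>UNIV. a l k * (p l s \<bullet> (w k s - w l s)))"
        using True by (simp add: p_def power2_eq_square algebra_simps sum_distrib_left)
      finally show ?thesis .
    qed (simp add: p_def max_def)
    then have "(\<Sum>l\<in>UNIV. p l s * w' l s)
        \<le> (\<Sum>l\<in>UNIV. K * (p l s)\<^sup>2 + c * (\<Sum>k\<in>UNIV. a l k * (p l s \<bullet> (w k s - w l s))))"
      by (intro sum_mono)
    also have "\<dots> = K * \<Phi> s + c * (\<Sum>l\<in>UNIV. \<Sum>k\<in>UNIV. a l k * (p l s \<bullet> (w k s - w l s)))"
      by (simp add: sum.distrib sum_distrib_left \<Phi>_def)
    also have "\<dots> \<le> K * \<Phi> s"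
    proof -
      have "0 \<le> a l k * ((p k s - p l s) \<bullet> (w k s - w l s))" for k l
        by (intro mult_nonneg_nonneg nonneg) (auto simp: p_def max_def mult_nonpos_nonpos zero_le_mult_iff)
      then have "(\<Sum>l\<in>UNIV. \<Sum>k\<in>UNIV. a l k * (p l s \<bullet> (w k s - w l s))) \<le> 0"
        by (subst summation_by_parts) (simp add: sum_nonneg)
      then show ?thesis using \<open>0 \<le> c\<close> by (simp add: mult_nonneg_nonpos)
    qed
    finally show "(\<Sum>l\<in>UNIV. 2 * p l s * w' l s) \<le> 2 * K * \<Phi> s"
      by (simp add: mult.assoc sum_distrib_left[symmetric])
  qed
  moreover have "\<Phi> 0 = 0"
    using init by (simp add: \<Phi>_def p_def max_absorb1)
  ultimately have "\<Phi> t \<le> 0" by simp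
  then have "\<Phi> t = 0" unfolding \<Phi>_def by (intro antisym sum_nonneg) auto
  then have "p l t = 0" by (simp add: \<Phi>_def sum_nonneg_eq_0_iff)
  then show ?thesis by (simp add: p_def)
qed

lemma square_weighted_sum_le:
  fixes d :: "'n \<Rightarrow> real"
  shows "(\<Sum>k\<in>UNIV. a l k * d k)\<^sup>2 \<le> (\<Sum>k\<in>UNIV. a l k) * (\<Sum>k\<in>UNIV. a l k * (d k)\<^sup>2)"
proof -
  have "(\<Sum>k\<in>UNIV. sqrt (a l k) * (sqrt (a l k) * d k))\<^sup>2
      \<le> (\<Sum>k\<in>UNIV. (sqrt (a l k))\<^sup>2) * (\<Sum>k\<in>UNIV. (sqrt (a l k) * d k)\<^sup>2)"
    by (rule Cauchy_Schwarz_ineq_sum)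
  then show ?thesis
    by (simp add: nonneg power_mult_distrib mult.assoc[symmetric])
qed

end

locale connected_weights = symmetric_weights a for a :: "'n::finite \<Rightarrow> 'n \<Rightarrow> real" +
  assumes conn: "(j, l) \<in> {(l, k). 0 < a l k}\<^sup>*"
begin

text \<open>
  Each edge is controlled by the Dirichlet form, and the triangle inequality propagates the bound along a
  path. The constant depends on the weights only.
\<close>

lemma poincare_inequality:
  obtains P where "P > 0" and "\<And>(q :: 'n \<Rightarrow> real) j l. (q l - q j)\<^sup>2 \<le> P * dirichlet_form q"
proof -
  have edge: "(q k - q l)\<^sup>2 \<le> (1 / a l k) * dirichlet_form q" if "0 < a l k" for l k and q :: "'n \<Rightarrow> real"
  proof -
    have "a l k * (q k - q l)\<^sup>2 \<le> (\<Sum>k\<in>UNIV. a l k * (q k - q l)\<^sup>2)"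
      by (rule member_le_sum) (auto simp: nonneg)
    also have "\<dots> \<le> dirichlet_form q"
      unfolding dirichlet_form_def real_norm_def power2_abs
      by (rule member_le_sum) (auto intro!: sum_nonneg simp: nonneg)
    finally show ?thesis using that by (simp add: field_simps)
  qed
  have pair: "\<exists>P. \<forall>q :: 'n \<Rightarrow> real. (q l - q j)\<^sup>2 \<le> P * dirichlet_form q" for j l
    using conn[of j l]
  proof (induction rule: rtrancl_induct)
    case base
    show ?case by (rule exI[of _ 0]) simp
  next
    case (step l k)
    then obtain P where P: "\<And>q :: 'n \<Rightarrow> real. (q l - q j)\<^sup>2 \<le> P * dirichlet_form q" by blast
    have "(q k - q j)\<^sup>2 \<le> (2 * P + 2 * (1 / a l k)) * dirichlet_form q" for q :: "'n \<Rightarrow> real"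
    proof -
      have "(q k - q j)\<^sup>2 \<le> 2 * (q l - q j)\<^sup>2 + 2 * (q k - q l)\<^sup>2"
        using sum_squares_bound[of "q l - q j" "q k - q l"]
        by (simp add: power2_eq_square algebra_simps)
      then show ?thesis
        using P[of q] edge[of l k q] step(2) by (simp add: algebra_simps)
    qed
    then show ?case by blast
  qed
  define P where "P j l = (SOME P. \<forall>q :: 'n \<Rightarrow> real. (q l - q j)\<^sup>2 \<le> P * dirichlet_form q)" for j l
  have P: "(q l - q j)\<^sup>2 \<le> P j l * dirichlet_form q" for j l and q :: "'n \<Rightarrow> real"
    using someI_ex[OF pair[of l j]] by (simp add: P_def)
  define P' where "P' = 1 + (\<Sum>j\<in>UNIV. \<Sum>l\<in>UNIV. \<bar>P j l\<bar>)"
  have le: "P j l \<le> P'" for j l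
  proof -
    have "\<bar>P j l\<bar> \<le> (\<Sum>l\<in>UNIV. \<bar>P j l\<bar>)" by (rule member_le_sum) auto
    also have "\<dots> \<le> (\<Sum>j\<in>UNIV. \<Sum>l\<in>UNIV. \<bar>P j l\<bar>)"
      by (rule member_le_sum) (auto intro: sum_nonneg)
    finally show ?thesis by (simp add: P'_def)
  qed
  show ?thesis
  proof
    show "P' > 0" unfolding P'_def by (intro add_pos_nonneg sum_nonneg) auto
    show "(q l - q j)\<^sup>2 \<le> P' * dirichlet_form q" for q :: "'n \<Rightarrow> real" and j l
      using P[of q l j] mult_right_mono[OF le[of j l] dirichlet_form_nonneg[of q]] by linarith
  qed
qed

end

section \<open>Energy, dissipation and the distance to equilibrium\<close>

text \<open>
  Coercivity in the form \<open>\<kappa> A \<le> \<langle>b, h\<rangle>\<close> with \<open>|b|\<^sup>2 \<le> P A\<close> turns a residual \<open>h\<close> into a bound for \<open>A\<close>.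
\<close>

lemma absorb_by_Cauchy_Schwarz:
  fixes b h :: "'n::finite \<Rightarrow> real"
  assumes "0 < \<kappa>" "0 \<le> A" and le: "\<kappa> * A \<le> (\<Sum>l\<in>UNIV. b l * h l)"
    and b: "(\<Sum>l\<in>UNIV. (b l)\<^sup>2) \<le> P * A" and "0 \<le> P"
  shows "\<kappa>\<^sup>2 * A \<le> P * (\<Sum>l\<in>UNIV. (h l)\<^sup>2)"
proof (cases "A = 0")
  case True
  then show ?thesis using \<open>0 \<le> P\<close> by (simp add: sum_nonneg)
next
  case False
  with \<open>0 \<le> A\<close> have "A > 0" by simp
  have "(\<kappa> * A)\<^sup>2 \<le> (\<Sum>l\<in>UNIV. b l * h l)\<^sup>2"
    using le \<open>0 < \<kappa>\<close> \<open>A > 0\<close> by (intro power_mono) auto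
  also have "\<dots> \<le> (\<Sum>l\<in>UNIV. (b l)\<^sup>2) * (\<Sum>l\<in>UNIV. (h l)\<^sup>2)"
    by (rule Cauchy_Schwarz_ineq_sum)
  also have "\<dots> \<le> P * A * (\<Sum>l\<in>UNIV. (h l)\<^sup>2)"
    by (intro mult_right_mono b sum_nonneg) auto
  finally have "A * (\<kappa>\<^sup>2 * A) \<le> A * (P * (\<Sum>l\<in>UNIV. (h l)\<^sup>2))"
    by (simp add: power2_eq_square mult_ac)
  then show ?thesis using \<open>A > 0\<close> by simp
qed

locale oscillator_network = connected_weights a for a :: "'n::finite \<Rightarrow> 'n \<Rightarrow> real" +
  fixes c \<mu> :: real
  assumes c: "0 < c" and \<mu>: "0 < \<mu>"
begin

definition field :: "('n \<Rightarrow> complex) \<Rightarrow> 'n \<Rightarrow> complex" where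
  "field u l = (\<mu> - (cmod (u l))\<^sup>2) *\<^sub>R u l + c *\<^sub>R (\<Sum>k\<in>UNIV. a l k *\<^sub>R (u k - u l))"

text \<open>
  The real potential of which \<open>field\<close> is the negative gradient, normalised to vanish exactly on the
  synchronized states.
\<close>

definition energy :: "('n \<Rightarrow> complex) \<Rightarrow> real" where
  "energy u = (\<Sum>l\<in>UNIV. ((cmod (u l))\<^sup>2 - \<mu>)\<^sup>2) / 4 + c / 4 * dirichlet_form u"

definition dissipation :: "('n \<Rightarrow> complex) \<Rightarrow> real" where
  "dissipation u = (\<Sum>l\<in>UNIV. (cmod (field u l))\<^sup>2)"

lemma energy_nonneg: "0 \<le> energy u"
  using dirichlet_form_nonneg[of u] c by (auto simp: energy_def intro!: add_nonneg_nonneg sum_nonneg)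

lemma dissipation_nonneg: "0 \<le> dissipation u"
  by (simp add: dissipation_def sum_nonneg)

lemma cmod_field_le: "(cmod (field u l))\<^sup>2 \<le> dissipation u"
  unfolding dissipation_def by (rule member_le_sum) auto

lemma Re_field: "Re (field u l) = (\<mu> - (cmod (u l))\<^sup>2) * Re (u l) + c * (\<Sum>k\<in>UNIV. a l k * (Re (u k) - Re (u l)))"
  by (simp add: field_def Re_sum)

lemma Im_field: "Im (field u l) = (\<mu> - (cmod (u l))\<^sup>2) * Im (u l) + c * (\<Sum>k\<in>UNIV. a l k * (Im (u k) - Im (u l)))"
  by (simp add: field_def Im_sum)

text \<open>
  The component \<open>x\<^sub>l Im g\<^sub>l - y\<^sub>l Re g\<^sub>l\<close> of the field \<open>g\<close> is blind to the radial term and equals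
  \<open>c \<Sum>\<^sub>k a\<^sub>l\<^sub>k x\<^sub>l x\<^sub>k (q\<^sub>k - q\<^sub>l)\<close>, the Laplacian of the slopes for the symmetric weights \<open>a\<^sub>l\<^sub>k x\<^sub>l x\<^sub>k\<close>. These
  are at least \<open>m\<^sup>2 a\<^sub>l\<^sub>k\<close>, so testing with \<open>q\<^sub>j - q\<^sub>l\<close> is coercive. Slopes are used in place of angles since
  they make this identity exact.
\<close>

lemma phase_error_bound:
  assumes "0 < m"
  obtains C where "C > 0" and
    "\<And>u l j. (\<And>l. m \<le> Re (u l) \<and> cmod (u l) \<le> M) \<Longrightarrow>
      (Im (u l) / Re (u l) - Im (u j) / Re (u j))\<^sup>2 \<le> C * dissipation u"
proof -
  obtain P where P: "P > 0" "\<And>(q :: 'n \<Rightarrow> real) j l. (q l - q j)\<^sup>2 \<le> P * dirichlet_form q"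
    using poincare_inequality by blast
  define \<kappa> where "\<kappa> = c * m\<^sup>2 / 2"
  have \<kappa>: "\<kappa> > 0" using c \<open>0 < m\<close> by (simp add: \<kappa>_def)
  define C where "C = P * (CARD('n) * P * M\<^sup>2) / \<kappa>\<^sup>2"
  have bound: "(Im (u l) / Re (u l) - Im (u j) / Re (u j))\<^sup>2 \<le> C * dissipation u"
    if u: "\<And>l. m \<le> Re (u l) \<and> cmod (u l) \<le> M" for u l j
  proof -
    define x y q where "x l = Re (u l)" and "y l = Im (u l)" and "q l = Im (u l) / Re (u l)" for l
    have xm: "m \<le> x l" and xpos: "x l > 0" and y: "y l = q l * x l" for l
      using u[of l] \<open>0 < m\<close> by (auto simp: x_def y_def q_def)
    define h where "h l = x l * Im (field u l) - y l * Re (field u l)" for l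
    have h: "h l = c * (\<Sum>k\<in>UNIV. a l k * (x l * x k) * (q k - q l))" for l
    proof -
      have "h l = c * (x l * (\<Sum>k\<in>UNIV. a l k * (y k - y l)) - y l * (\<Sum>k\<in>UNIV. a l k * (x k - x l)))"
        unfolding h_def Re_field Im_field x_def[symmetric] y_def[symmetric] by algebra
      also have "x l * (\<Sum>k\<in>UNIV. a l k * (y k - y l)) - y l * (\<Sum>k\<in>UNIV. a l k * (x k - x l))
          = (\<Sum>k\<in>UNIV. x l * (a l k * (y k - y l)) - y l * (a l k * (x k - x l)))"
        by (simp only: sum_subtractf sum_distrib_left)
      also have "(\<Sum>k\<in>UNIV. x l * (a l k * (y k - y l)) - y l * (a l k * (x k - x l)))
          = (\<Sum>k\<in>UNIV. a l k * (x l * x k) * (q k - q l))"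
        by (rule sum.cong) (simp_all add: y algebra_simps)
      finally show ?thesis .
    qed
    interpret W: symmetric_weights "\<lambda>l k. a l k * (x l * x k)"
      by unfold_locales (simp_all add: sym mult_ac nonneg less_imp_le[OF xpos])
    have "\<kappa> * dirichlet_form q \<le> c / 2 * W.dirichlet_form q"
    proof -
      have "m\<^sup>2 * dirichlet_form q \<le> W.dirichlet_form q"
        unfolding dirichlet_form_def W.dirichlet_form_def sum_distrib_left
      proof (intro sum_mono)
        fix l k
        have "m\<^sup>2 \<le> x l * x k"
          using mult_mono[OF xm[of l] xm[of k]] \<open>0 < m\<close> xpos[of l] by (simp add: power2_eq_square)
        then show "m\<^sup>2 * (a l k * (norm (q k - q l))\<^sup>2) \<le> a l k * (x l * x k) * (norm (q k - q l))\<^sup>2"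
          using mult_right_mono[of "m\<^sup>2" "x l * x k" "a l k * (norm (q k - q l))\<^sup>2"] nonneg[of l k]
          by (simp add: mult_ac)
      qed
      then show ?thesis using c by (simp add: \<kappa>_def)
    qed
    also have "\<dots> = (\<Sum>l\<in>UNIV. (q j - q l) * h l)"
    proof -
      have "(\<Sum>l\<in>UNIV. (q l - q j) * h l)
          = c * (\<Sum>l\<in>UNIV. \<Sum>k\<in>UNIV. a l k * (x l * x k) * ((q l - q j) \<bullet> (q k - q l)))"
        by (simp add: h sum_distrib_left mult_ac)
      also have "\<dots> = - (c / 2 * W.dirichlet_form q)"
        by (subst W.sum_inner_differences) simp
      finally have "c / 2 * W.dirichlet_form q = - (\<Sum>l\<in>UNIV. (q l - q j) * h l)" by simp
      also have "\<dots> = (\<Sum>l\<in>UNIV. (q j - q l) * h l)"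
        by (simp add: sum_negf[symmetric] algebra_simps)
      finally show ?thesis .
    qed
    finally have "\<kappa>\<^sup>2 * dirichlet_form q \<le> CARD('n) * P * (\<Sum>l\<in>UNIV. (h l)\<^sup>2)"
    proof (rule absorb_by_Cauchy_Schwarz[OF \<kappa> dirichlet_form_nonneg])
      show "0 \<le> CARD('n) * P" using P(1) by simp
      have "(\<Sum>l\<in>UNIV. (q j - q l)\<^sup>2) \<le> (\<Sum>l\<in>(UNIV::'n set). P * dirichlet_form q)"
        by (intro sum_mono P(2))
      then show "(\<Sum>l\<in>UNIV. (q j - q l)\<^sup>2) \<le> CARD('n) * P * dirichlet_form q" by simp
    qed
    also have "\<dots> \<le> CARD('n) * P * (M\<^sup>2 * dissipation u)"
    proof (intro mult_left_mono)
      have "(h l)\<^sup>2 \<le> M\<^sup>2 * (cmod (field u l))\<^sup>2" for l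
      proof -
        have "h l = Im (cnj (u l) * field u l)"
          by (simp add: h_def x_def y_def)
        then have "\<bar>h l\<bar> \<le> cmod (u l) * cmod (field u l)"
          by (metis abs_Im_le_cmod norm_mult complex_mod_cnj)
        also have "\<dots> \<le> M * cmod (field u l)"
          using u[of l] by (intro mult_right_mono) auto
        finally have "\<bar>h l\<bar>\<^sup>2 \<le> (M * cmod (field u l))\<^sup>2" by (intro power_mono) auto
        then show ?thesis by (simp add: power_mult_distrib)
      qed
      then show "(\<Sum>l\<in>UNIV. (h l)\<^sup>2) \<le> M\<^sup>2 * dissipation u"
        unfolding dissipation_def sum_distrib_left by (intro sum_mono)
    qed (use P in auto)
    finally have "dirichlet_form q \<le> (CARD('n) * P * M\<^sup>2) / \<kappa>\<^sup>2 * dissipation u"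
      using \<kappa> by (simp add: field_simps)
    then have "P * dirichlet_form q \<le> C * dissipation u"
      using P(1) mult_left_mono[of "dirichlet_form q" "(CARD('n) * P * M\<^sup>2) / \<kappa>\<^sup>2 * dissipation u" P]
      by (simp add: C_def)
    then show ?thesis using P(2)[of q l j] unfolding q_def by linarith
  qed
  (* C vanishes for M = 0, whereas a positive constant is claimed. *)
  have "C * dissipation u \<le> (\<bar>C\<bar> + 1) * dissipation u" for u
    by (intro mult_right_mono dissipation_nonneg) auto
  with bound have "(Im (u l) / Re (u l) - Im (u j) / Re (u j))\<^sup>2 \<le> (\<bar>C\<bar> + 1) * dissipation u"
    if "\<And>l. m \<le> Re (u l) \<and> cmod (u l) \<le> M" for u l j
    using that order_trans by blast
  then show ?thesis by (intro that[of "\<bar>C\<bar> + 1"]) auto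
qed

text \<open>
  The nearby equilibrium is the point of modulus \<open>sqrt \<mu>\<close> in the direction of a reference component \<open>u\<^sub>j\<close>.
  With \<open>\<xi>\<close> its real part, the real part of the field tested with \<open>\<xi> - x\<^sub>l\<close> is coercive in \<open>x\<^sub>l - \<xi>\<close>, up to an
  error from the differences of slopes that is already controlled by the dissipation.
\<close>

lemma distance_to_equilibrium_bound:
  assumes "0 < m"
  obtains C where "C > 0" and
    "\<And>u. (\<And>l. m \<le> Re (u l) \<and> cmod (u l) \<le> M) \<Longrightarrow>
      \<exists>v. cmod v = sqrt \<mu> \<and> (\<forall>l. (cmod (u l - v))\<^sup>2 \<le> C * dissipation u)"
proof -
  obtain C1 where C1: "C1 > 0" "\<And>u l j. (\<And>l. m \<le> Re (u l) \<and> cmod (u l) \<le> M) \<Longrightarrow>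
      (Im (u l) / Re (u l) - Im (u j) / Re (u j))\<^sup>2 \<le> C1 * dissipation u"
    using phase_error_bound[OF \<open>0 < m\<close>] by metis
  define C2 where "C2 = (2 + CARD('n) * (2 * (M^3 * (2 * (M / m)))\<^sup>2 * C1)) / (m\<^sup>2)\<^sup>2"
  define C where "C = (1 + 2 * (M / m)\<^sup>2) * C2 + 2 * M\<^sup>2 * C1"
  have "C2 > 0" unfolding C2_def using C1 \<open>0 < m\<close>
    by (intro divide_pos_pos add_pos_nonneg) auto
  then have "C > 0" unfolding C_def using C1
    by (intro add_pos_nonneg mult_pos_pos) auto
  then show ?thesis
  proof (rule that)
    fix u :: "'n \<Rightarrow> complex" assume u: "\<And>l. m \<le> Re (u l) \<and> cmod (u l) \<le> M"
    define x q :: "'n \<Rightarrow> real" where "x l = Re (u l)" and "q l = Im (u l) / Re (u l)" for l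
    have xm: "m \<le> x l" and xpos: "x l > 0" and y: "Im (u l) = q l * x l" and xM: "x l \<le> M" for l
      using u[of l] \<open>0 < m\<close> complex_Re_le_cmod[of "u l"] by (auto simp: x_def q_def)
    have "M > 0" using xm xM \<open>0 < m\<close> by (meson less_le_trans order_trans)
    have qM: "\<bar>q l\<bar> \<le> M / m" for l
    proof -
      have "\<bar>Im (u l)\<bar> \<le> M" using u[of l] abs_Im_le_cmod[of "u l"] by linarith
      then show ?thesis
        using xm[of l] \<open>0 < m\<close> \<open>M > 0\<close> unfolding q_def x_def[symmetric] abs_divide
        by (intro frac_le) auto
    qed
    have nu: "(cmod (u l))\<^sup>2 = (x l)\<^sup>2 * (1 + (q l)\<^sup>2)" for l
      by (simp add: cmod_power2 y x_def[symmetric] power_mult_distrib algebra_simps)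
    define j :: 'n where "j = undefined"
    define \<xi> where "\<xi> = sqrt (\<mu> / (1 + (q j)\<^sup>2))"
    have q1: "1 + (q j)\<^sup>2 > 0" by (simp add: add_pos_nonneg)
    have \<xi>: "0 < \<xi>" "\<mu> = \<xi>\<^sup>2 * (1 + (q j)\<^sup>2)"
      using \<mu> q1 by (auto simp: \<xi>_def)
    have dq: "(q l - q j)\<^sup>2 \<le> C1 * dissipation u" for l
      unfolding q_def by (rule C1(2)[OF u])
    define b where "b l = x l - \<xi>" for l
    define h where "h l = - Re (field u l) - x l ^ 3 * ((q l)\<^sup>2 - (q j)\<^sup>2)" for l
    (* The correction in h replaces the slope of u_l by that of u_j, which makes mu minus the squared
       modulus divisible by x_l - xi. *)
    have bh: "b l * h l = (1 + (q j)\<^sup>2) * (x l * (x l + \<xi>)) * (b l)\<^sup>2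
        - c * (\<Sum>k\<in>UNIV. a l k * ((x l - \<xi>) \<bullet> (x k - x l)))" for l
    proof -
      have "b l * h l = b l * ((x l)\<^sup>2 * (1 + (q l)\<^sup>2) - \<xi>\<^sup>2 * (1 + (q j)\<^sup>2)) * x l
          - b l * x l ^ 3 * ((q l)\<^sup>2 - (q j)\<^sup>2) - c * (b l * (\<Sum>k\<in>UNIV. a l k * (x k - x l)))"
        unfolding h_def Re_field nu \<xi>(2)[symmetric] x_def[symmetric] by (simp add: algebra_simps)
      moreover have "b l * ((x l)\<^sup>2 * (1 + (q l)\<^sup>2) - \<xi>\<^sup>2 * (1 + (q j)\<^sup>2)) * x l
          - b l * x l ^ 3 * ((q l)\<^sup>2 - (q j)\<^sup>2) = (1 + (q j)\<^sup>2) * (x l * (x l + \<xi>)) * (b l)\<^sup>2"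
        unfolding b_def by algebra
      moreover have "b l * (\<Sum>k\<in>UNIV. a l k * (x k - x l))
          = (\<Sum>k\<in>UNIV. a l k * ((x l - \<xi>) \<bullet> (x k - x l)))"
        by (simp add: b_def sum_distrib_left mult_ac)
      ultimately show ?thesis by simp
    qed
    have "m\<^sup>2 * (\<Sum>l\<in>UNIV. (b l)\<^sup>2) \<le> (\<Sum>l\<in>UNIV. b l * h l)"
    proof -
      have "m\<^sup>2 * (b l)\<^sup>2 \<le> (1 + (q j)\<^sup>2) * (x l * (x l + \<xi>)) * (b l)\<^sup>2" for l
      proof (rule mult_right_mono)
        have "m\<^sup>2 \<le> x l * (x l + \<xi>)"
          using xm[of l] \<open>0 < m\<close> \<xi>(1) unfolding power2_eq_square by (intro mult_mono) auto
        also have "\<dots> \<le> (1 + (q j)\<^sup>2) * (x l * (x l + \<xi>))"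
          using xpos[of l] \<xi>(1) by (simp add: algebra_simps)
        finally show "m\<^sup>2 \<le> (1 + (q j)\<^sup>2) * (x l * (x l + \<xi>))" .
      qed simp
      then have "m\<^sup>2 * (\<Sum>l\<in>UNIV. (b l)\<^sup>2) \<le> (\<Sum>l\<in>UNIV. (1 + (q j)\<^sup>2) * (x l * (x l + \<xi>)) * (b l)\<^sup>2)"
        unfolding sum_distrib_left by (intro sum_mono)
      also have "\<dots> \<le> (\<Sum>l\<in>UNIV. b l * h l)"
        unfolding bh sum_subtractf sum_distrib_left[symmetric] sum_inner_differences
        using c dirichlet_form_nonneg[of x] by simp
      finally show ?thesis .
    qed
    then have "(m\<^sup>2)\<^sup>2 * (\<Sum>l\<in>UNIV. (b l)\<^sup>2) \<le> 1 * (\<Sum>l\<in>UNIV. (h l)\<^sup>2)"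
      using \<open>0 < m\<close> by (intro absorb_by_Cauchy_Schwarz[where b = b]) (auto intro: sum_nonneg)
    also have "\<dots> \<le> (2 + CARD('n) * (2 * (M^3 * (2 * (M / m)))\<^sup>2 * C1)) * dissipation u"
    proof -
      have "(h l)\<^sup>2 \<le> 2 * (cmod (field u l))\<^sup>2 + 2 * (M^3 * (2 * (M / m)))\<^sup>2 * C1 * dissipation u" for l
      proof -
        define e where "e = x l ^ 3 * ((q l)\<^sup>2 - (q j)\<^sup>2)"
        have hl: "h l = - Re (field u l) - e"
          by (simp add: h_def e_def)
        have "(h l)\<^sup>2 \<le> 2 * (Re (field u l))\<^sup>2 + 2 * e\<^sup>2"
          using sum_squares_bound[of "Re (field u l)" e]
          unfolding hl by (simp add: power2_eq_square algebra_simps)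
        moreover have "(Re (field u l))\<^sup>2 \<le> (cmod (field u l))\<^sup>2"
          using power_mono[OF abs_Re_le_cmod[of "field u l"], of 2] by simp
        moreover have "e\<^sup>2 \<le> (M^3 * (2 * (M / m)))\<^sup>2 * (C1 * dissipation u)"
        proof -
          have "e\<^sup>2 = (x l ^ 3 * \<bar>q l + q j\<bar>)\<^sup>2 * (q l - q j)\<^sup>2"
            unfolding e_def power_mult_distrib power2_abs by algebra
          also have "\<dots> \<le> (M^3 * (2 * (M / m)))\<^sup>2 * (C1 * dissipation u)"
          proof (intro mult_mono dq power_mono)
            show "x l \<le> M" by (rule xM)
            show "\<bar>q l + q j\<bar> \<le> 2 * (M / m)" using qM[of l] qM[of j] by linarith
          qed (use xpos[of l] \<open>M > 0\<close> \<open>0 < m\<close> in auto)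
          finally show ?thesis .
        qed
        ultimately show ?thesis by (simp add: mult.assoc)
      qed
      then have "(\<Sum>l\<in>UNIV. (h l)\<^sup>2) \<le> (\<Sum>l\<in>(UNIV::'n set).
          2 * (cmod (field u l))\<^sup>2 + 2 * (M^3 * (2 * (M / m)))\<^sup>2 * C1 * dissipation u)"
        by (intro sum_mono)
      also have "\<dots> = (2 + CARD('n) * (2 * (M^3 * (2 * (M / m)))\<^sup>2 * C1)) * dissipation u"
        by (simp only: sum.distrib sum_distrib_left[symmetric] dissipation_def[symmetric] sum_constant
            distrib_right mult.assoc) (simp add: mult_ac)
      finally show ?thesis by simp
    qed
    finally have sb: "(\<Sum>l\<in>UNIV. (b l)\<^sup>2) \<le> C2 * dissipation u"
      using \<open>0 < m\<close> by (simp add: C2_def field_simps)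
    have b2: "(b l)\<^sup>2 \<le> C2 * dissipation u" for l
      using member_le_sum[of l UNIV "\<lambda>l. (b l)\<^sup>2"] sb by simp
    define v where "v = Complex \<xi> (\<xi> * q j)"
    have "cmod v = sqrt \<mu>"
      by (simp add: v_def cmod_def \<xi>(2) power_mult_distrib distrib_left)
    moreover have "(cmod (u l - v))\<^sup>2 \<le> C * dissipation u" for l
    proof -
      have "(cmod (u l - v))\<^sup>2 = (b l)\<^sup>2 + (x l * (q l - q j) + q j * b l)\<^sup>2"
        by (simp add: cmod_power2 v_def b_def y x_def[symmetric] algebra_simps)
      also have "\<dots> \<le> (b l)\<^sup>2 + (2 * (x l)\<^sup>2 * (q l - q j)\<^sup>2 + 2 * (q j)\<^sup>2 * (b l)\<^sup>2)"
        using sum_squares_bound[of "x l * (q l - q j)" "q j * b l"]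
        by (simp add: power2_sum power_mult_distrib) (simp add: mult_ac)
      also have "\<dots> = (1 + 2 * (q j)\<^sup>2) * (b l)\<^sup>2 + 2 * (x l)\<^sup>2 * (q l - q j)\<^sup>2"
        by (simp add: algebra_simps)
      also have "\<dots> \<le> (1 + 2 * (M / m)\<^sup>2) * (C2 * dissipation u) + 2 * M\<^sup>2 * (C1 * dissipation u)"
      proof (intro add_mono mult_mono b2 dq mult_left_mono)
        show "(q j)\<^sup>2 \<le> (M / m)\<^sup>2" using power_mono[OF qM[of j], of 2] by simp
        show "(x l)\<^sup>2 \<le> M\<^sup>2" using xpos[of l] xM[of l] by (intro power_mono) auto
      qed auto
      also have "\<dots> = C * dissipation u" by (simp add: C_def algebra_simps)
      finally show ?thesis .
    qed
    ultimately show "\<exists>v. cmod v = sqrt \<mu> \<and> (\<forall>l. (cmod (u l - v))\<^sup>2 \<le> C * dissipation u)" by blast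
  qed
qed

lemma energy_le_distance:
  assumes u: "\<And>l. cmod (u l) \<le> M" and v: "cmod v = sqrt \<mu>" and R: "\<And>l. (cmod (u l - v))\<^sup>2 \<le> R"
  shows "energy u \<le> (CARD('n) * (M + sqrt \<mu>)\<^sup>2 / 4 + c * (\<Sum>l\<in>UNIV. \<Sum>k\<in>UNIV. a l k)) * R"
proof -
  have 1: "((cmod (u l))\<^sup>2 - \<mu>)\<^sup>2 \<le> (M + sqrt \<mu>)\<^sup>2 * R" for l
  proof -
    have "((cmod (u l))\<^sup>2 - \<mu>)\<^sup>2 = (cmod (u l) + cmod v)\<^sup>2 * (cmod (u l) - cmod v)\<^sup>2"
    proof -
      have "(cmod v)\<^sup>2 = \<mu>" using v \<mu> by simp
      then show ?thesis by (metis power_mult_distrib square_diff_square_factored power2_eq_square)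
    qed
    also have "\<dots> \<le> (M + sqrt \<mu>)\<^sup>2 * R"
    proof (intro mult_mono)
      show "(cmod (u l) + cmod v)\<^sup>2 \<le> (M + sqrt \<mu>)\<^sup>2"
        using u[of l] v \<mu> by (intro power_mono) auto
      have "(cmod (u l) - cmod v)\<^sup>2 \<le> (cmod (u l - v))\<^sup>2"
        using power_mono[OF norm_triangle_ineq3[of "u l" v], of 2] by simp
      then show "(cmod (u l) - cmod v)\<^sup>2 \<le> R" using R[of l] by linarith
    qed auto
    finally show ?thesis .
  qed
  have 2: "(cmod (u k - u l))\<^sup>2 \<le> 4 * R" for k l
  proof -
    have "(cmod (u k - u l))\<^sup>2 \<le> (cmod (u k - v) + cmod (u l - v))\<^sup>2"
      using norm_triangle_ineq4[of "u k - v" "u l - v"] by (intro power_mono) auto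
    also have "\<dots> \<le> 2 * (cmod (u k - v))\<^sup>2 + 2 * (cmod (u l - v))\<^sup>2"
      using sum_squares_bound[of "cmod (u k - v)" "cmod (u l - v)"] by (simp add: power2_sum)
    finally show ?thesis using R[of k] R[of l] by linarith
  qed
  have "(\<Sum>l\<in>UNIV. ((cmod (u l))\<^sup>2 - \<mu>)\<^sup>2) \<le> (\<Sum>l\<in>(UNIV::'n set). (M + sqrt \<mu>)\<^sup>2 * R)"
    by (intro sum_mono 1)
  moreover have "dirichlet_form u \<le> (\<Sum>l\<in>UNIV. \<Sum>k\<in>UNIV. a l k * (4 * R))"
    unfolding dirichlet_form_def by (intro sum_mono mult_left_mono 2 nonneg)
  then have "c / 4 * dirichlet_form u \<le> c / 4 * ((\<Sum>l\<in>UNIV. \<Sum>k\<in>UNIV. a l k) * (4 * R))"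
    using c by (intro mult_left_mono) (auto simp: sum_distrib_right)
  ultimately show ?thesis by (simp add: energy_def algebra_simps)
qed

text \<open>
  For bounded moduli both terms of the field are bounded by square roots of terms of the energy, so decay of the energy is
  decay of the velocity.
\<close>

lemma dissipation_le_energy:
  assumes u: "\<And>l. cmod (u l) \<le> M"
  shows "dissipation u \<le> (8 * M\<^sup>2 + 8 * c * (\<Sum>l\<in>UNIV. \<Sum>k\<in>UNIV. a l k)) * energy u"
proof -
  define A where "A = (\<Sum>l\<in>UNIV. \<Sum>k\<in>UNIV. a l k)"
  have A: "(\<Sum>k\<in>UNIV. a l k) \<le> A" for l
    unfolding A_def by (rule member_le_sum) (auto intro: sum_nonneg simp: nonneg)
  have "(cmod (field u l))\<^sup>2 \<le> 2 * M\<^sup>2 * ((cmod (u l))\<^sup>2 - \<mu>)\<^sup>2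
      + 2 * c\<^sup>2 * A * (\<Sum>k\<in>UNIV. a l k * (cmod (u k - u l))\<^sup>2)" for l
  proof -
    define \<alpha> \<beta> where "\<alpha> = \<bar>\<mu> - (cmod (u l))\<^sup>2\<bar> * M" and "\<beta> = c * (\<Sum>k\<in>UNIV. a l k * cmod (u k - u l))"
    have "cmod (field u l) \<le> \<alpha> + \<beta>"
      unfolding field_def
    proof (rule norm_triangle_mono)
      show "norm ((\<mu> - (cmod (u l))\<^sup>2) *\<^sub>R u l) \<le> \<alpha>"
        using u[of l] by (auto simp: \<alpha>_def intro!: mult_left_mono)
      have "norm (\<Sum>k\<in>UNIV. a l k *\<^sub>R (u k - u l)) \<le> (\<Sum>k\<in>UNIV. a l k * cmod (u k - u l))"
        by (rule sum_norm_le) (simp add: nonneg)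
      then show "norm (c *\<^sub>R (\<Sum>k\<in>UNIV. a l k *\<^sub>R (u k - u l))) \<le> \<beta>"
        using c by (simp add: \<beta>_def)
    qed
    then have "(cmod (field u l))\<^sup>2 \<le> (\<alpha> + \<beta>)\<^sup>2" by (intro power_mono) auto
    also have "\<dots> \<le> 2 * \<alpha>\<^sup>2 + 2 * \<beta>\<^sup>2"
      using sum_squares_bound[of \<alpha> \<beta>] by (simp add: power2_sum)
    also have "\<alpha>\<^sup>2 = M\<^sup>2 * ((cmod (u l))\<^sup>2 - \<mu>)\<^sup>2"
      by (simp add: \<alpha>_def power_mult_distrib power2_commute)
    also have "\<beta>\<^sup>2 \<le> c\<^sup>2 * (A * (\<Sum>k\<in>UNIV. a l k * (cmod (u k - u l))\<^sup>2))"
      unfolding \<beta>_def power_mult_distrib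
      using A[of l] by (intro mult_left_mono order_trans[OF square_weighted_sum_le] mult_right_mono sum_nonneg)
        (auto simp: nonneg)
    finally show ?thesis by (simp add: mult_ac)
  qed
  then have "dissipation u \<le> (\<Sum>l\<in>UNIV. 2 * M\<^sup>2 * ((cmod (u l))\<^sup>2 - \<mu>)\<^sup>2
      + 2 * c\<^sup>2 * A * (\<Sum>k\<in>UNIV. a l k * (cmod (u k - u l))\<^sup>2))"
    unfolding dissipation_def by (intro sum_mono)
  also have "\<dots> = 8 * M\<^sup>2 * ((\<Sum>l\<in>UNIV. ((cmod (u l))\<^sup>2 - \<mu>)\<^sup>2) / 4)
      + 8 * c * A * (c / 4 * dirichlet_form u)"
    by (simp add: sum.distrib sum_distrib_left[symmetric] dirichlet_form_def power2_eq_square)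
  also have "\<dots> \<le> (8 * M\<^sup>2 + 8 * c * A) * energy u"
  proof -
    have "0 \<le> A" unfolding A_def by (intro sum_nonneg nonneg)
    then have "0 \<le> 8 * M\<^sup>2 * (c / 4 * dirichlet_form u)"
      and "0 \<le> 8 * c * A * ((\<Sum>l\<in>UNIV. ((cmod (u l))\<^sup>2 - \<mu>)\<^sup>2) / 4)"
      using c dirichlet_form_nonneg[of u] by (auto intro!: mult_nonneg_nonneg sum_nonneg)
    then show ?thesis unfolding energy_def distrib_left distrib_right by linarith
  qed
  finally show ?thesis by (simp add: A_def)
qed

end

section \<open>Exponential convergence of bounded trajectories\<close>

text \<open>
  By the mean value inequality the increments after time \<open>t\<close> are at most the tail \<open>C / \<gamma> exp (- \<gamma> t)\<close> of
  the integral of the bound.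
\<close>

lemma exponential_tail_bound:
  fixes f :: "real \<Rightarrow> 'a::banach"
  assumes deriv: "\<And>t. 0 \<le> t \<Longrightarrow> (f has_vector_derivative f' t) (at t within {0..})"
    and decay: "\<And>t. 0 \<le> t \<Longrightarrow> norm (f' t) \<le> C * exp (- \<gamma> * t)" and "\<gamma> > 0"
  obtains L where "\<And>t. 0 \<le> t \<Longrightarrow> norm (f t - L) \<le> C / \<gamma> * exp (- \<gamma> * t)"
proof -
  have "0 \<le> C" using order_trans[OF norm_ge_zero decay[of 0]] by simp
  define D where "D = C / \<gamma>"
  have D: "0 \<le> D" using \<open>0 \<le> C\<close> \<open>\<gamma> > 0\<close> by (simp add: D_def)
  have diff: "norm (f t - f s) \<le> D * exp (- \<gamma> * s)" if "0 \<le> s" "s \<le> t" for s t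
  proof (cases "s = t")
    case False
    then have "s < t" using that by simp
    have cont: "continuous_on {0..} f"
      using deriv has_vector_derivative_continuous by (fastforce simp: continuous_on_eq_continuous_within)
    have "norm (f t - f s) \<le> - D * exp (- \<gamma> * t) - (- D * exp (- \<gamma> * s))"
    proof (rule differentiable_bound_general[OF \<open>s < t\<close>])
      show "continuous_on {s..t} f" by (rule continuous_on_subset[OF cont]) (use that in auto)
      show "continuous_on {s..t} (\<lambda>t. - D * exp (- \<gamma> * t))" by (intro continuous_intros)
      fix r assume r: "s < r" "r < t"
      then show "(f has_vector_derivative f' r) (at r)"
        using deriv[of r] that at_within_interior[of r "{0..}"] by simp
      show "((\<lambda>t. - D * exp (- \<gamma> * t)) has_vector_derivative C * exp (- \<gamma> * r)) (at r)"
        using \<open>\<gamma> > 0\<close> unfolding has_real_derivative_iff_has_vector_derivative[symmetric] D_def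
        by (auto intro!: derivative_eq_intros)
      show "norm (f' r) \<le> C * exp (- \<gamma> * r)" using decay[of r] r that by simp
    qed
    also have "\<dots> \<le> D * exp (- \<gamma> * s)" using D by simp
    finally show ?thesis .
  qed (use D in simp)
  have lim0: "(\<lambda>n. D * exp (- \<gamma> * real n)) \<longlonglongrightarrow> 0"
  proof -
    have "((\<lambda>t. exp (- \<gamma> * t)) \<longlongrightarrow> 0) at_top"
      using \<open>\<gamma> > 0\<close> by real_asymp
    from tendsto_mult_right_zero[OF filterlim_compose[OF this filterlim_real_sequentially]]
    show ?thesis by simp
  qed
  have "Cauchy (\<lambda>n. f (real n))"
  proof (rule metric_CauchyI)
    fix e :: real assume "e > 0"
    then obtain N where N: "D * exp (- \<gamma> * real N) < e / 2"
      using order_tendstoD(2)[OF lim0, of "e / 2"] by (auto simp: eventually_sequentially)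
    have "norm (f (real n) - f (real N)) < e / 2" if "n \<ge> N" for n
      using diff[of "real N" "real n"] N that by simp
    then have "dist (f (real n)) (f (real N)) < e / 2" if "n \<ge> N" for n
      using that by (simp add: dist_norm)
    then show "\<exists>N. \<forall>m\<ge>N. \<forall>n\<ge>N. dist (f (real m)) (f (real n)) < e"
      by (meson dist_triangle_half_l dist_commute)
  qed
  then obtain L where L: "(\<lambda>n. f (real n)) \<longlonglongrightarrow> L"
    using Cauchy_convergent convergent_def by blast
  show ?thesis
  proof (rule that[of L])
    fix t :: real assume t: "0 \<le> t"
    have "norm (L - f t) \<le> D * exp (- \<gamma> * t)"
    proof (rule tendsto_upperbound)
      show "(\<lambda>n. norm (f (real n) - f t)) \<longlonglongrightarrow> norm (L - f t)"
        by (intro tendsto_intros L)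
      show "\<forall>\<^sub>F n in sequentially. norm (f (real n) - f t) \<le> D * exp (- \<gamma> * t)"
        using eventually_ge_at_top[of "nat \<lceil>t\<rceil>"]
        by eventually_elim (intro diff t, linarith)
    qed simp
    then show "norm (f t - L) \<le> C / \<gamma> * exp (- \<gamma> * t)" by (simp add: D_def norm_minus_commute)
  qed
qed

lemma nonpos_if_le_exponential_decay:
  fixes x :: real
  assumes "\<And>t. 0 \<le> t \<Longrightarrow> x \<le> C * exp (- \<gamma> * t)" and "\<gamma> > 0"
  shows "x \<le> 0"
proof (rule tendsto_lowerbound)
  show "((\<lambda>t. C * exp (- \<gamma> * t)) \<longlongrightarrow> 0) at_top"
    using \<open>\<gamma> > 0\<close> by real_asymp
  show "\<forall>\<^sub>F t in at_top. x \<le> C * exp (- \<gamma> * t)"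
    using eventually_ge_at_top[of 0] by eventually_elim (rule assms(1))
qed simp

context oscillator_network
begin

text \<open>
  The gradient structure: summation by parts turns the derivative of the coupling energy into the inner
  product of the velocity with the coupling term.
\<close>

lemma energy_has_derivative:
  assumes u: "\<And>l. ((\<lambda>s. u s l) has_vector_derivative field (u t) l) (at t within S)"
  shows "((\<lambda>s. energy (u s)) has_real_derivative - dissipation (u t)) (at t within S)"
proof -
  define p where "p l = (cmod (u t l))\<^sup>2 - \<mu>" for l
  define f where "f = field (u t)"
  have d1: "((\<lambda>s. ((cmod (u s l))\<^sup>2 - \<mu>)\<^sup>2) has_real_derivative 4 * p l * (u t l \<bullet> f l)) (at t within S)" for l
    unfolding p_def f_def
    by (rule derivative_eq_intros norm_square_has_real_derivative[OF u] refl | simp)+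
  have d2: "((\<lambda>s. (cmod (u s k - u s l))\<^sup>2) has_real_derivative
      2 * ((u t k - u t l) \<bullet> (f k - f l))) (at t within S)" for k l
    unfolding f_def by (intro norm_square_has_real_derivative has_vector_derivative_diff u)
  have "((\<lambda>s. energy (u s)) has_real_derivative
      (\<Sum>l\<in>UNIV. 4 * p l * (u t l \<bullet> f l)) / 4
      + c / 4 * (\<Sum>l\<in>UNIV. \<Sum>k\<in>UNIV. a l k * (2 * ((u t k - u t l) \<bullet> (f k - f l))))) (at t within S)"
    unfolding energy_def dirichlet_form_def
    by (intro DERIV_add DERIV_cdivide DERIV_cmult DERIV_sum d1 d2)
  moreover have "(\<Sum>l\<in>UNIV. 4 * p l * (u t l \<bullet> f l)) / 4
      + c / 4 * (\<Sum>l\<in>UNIV. \<Sum>k\<in>UNIV. a l k * (2 * ((u t k - u t l) \<bullet> (f k - f l)))) = - dissipation (u t)"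
  proof -
    have "dissipation (u t) = (\<Sum>l\<in>UNIV. f l \<bullet> f l)"
      by (simp add: dissipation_def f_def power2_norm_eq_inner)
    also have "\<dots> = (\<Sum>l\<in>UNIV. - (p l * (u t l \<bullet> f l)) + c * (\<Sum>k\<in>UNIV. a l k * (f l \<bullet> (u t k - u t l))))"
    proof (rule sum.cong[OF refl])
      fix l
      have "f l \<bullet> f l = f l \<bullet> ((- p l) *\<^sub>R u t l + c *\<^sub>R (\<Sum>k\<in>UNIV. a l k *\<^sub>R (u t k - u t l)))"
        by (subst (2) f_def) (simp add: field_def p_def)
      also have "\<dots> = - (p l * (u t l \<bullet> f l)) + c * (\<Sum>k\<in>UNIV. a l k * (f l \<bullet> (u t k - u t l)))"
        by (simp only: inner_add_right inner_scaleR_right inner_sum_right) (simp add: inner_commute)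
      finally show "f l \<bullet> f l = - (p l * (u t l \<bullet> f l)) + c * (\<Sum>k\<in>UNIV. a l k * (f l \<bullet> (u t k - u t l)))" .
    qed
    also have "\<dots> = - (\<Sum>l\<in>UNIV. p l * (u t l \<bullet> f l))
        + c * (\<Sum>l\<in>UNIV. \<Sum>k\<in>UNIV. a l k * (f l \<bullet> (u t k - u t l)))"
      by (simp only: sum.distrib sum_negf sum_distrib_left)
    also have "\<dots> = - (\<Sum>l\<in>UNIV. p l * (u t l \<bullet> f l))
        - c / 2 * (\<Sum>l\<in>UNIV. \<Sum>k\<in>UNIV. a l k * ((u t k - u t l) \<bullet> (f k - f l)))"
      by (subst summation_by_parts) (simp add: inner_commute)
    finally have "dissipation (u t) = - (\<Sum>l\<in>UNIV. p l * (u t l \<bullet> f l))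
        - c / 2 * (\<Sum>l\<in>UNIV. \<Sum>k\<in>UNIV. a l k * ((u t k - u t l) \<bullet> (f k - f l)))" .
    moreover have "(\<Sum>l\<in>UNIV. 4 * p l * (u t l \<bullet> f l)) = 4 * (\<Sum>l\<in>UNIV. p l * (u t l \<bullet> f l))"
      by (simp only: sum_distrib_left mult.assoc)
    moreover have "(\<Sum>l\<in>UNIV. \<Sum>k\<in>UNIV. a l k * (2 * ((u t k - u t l) \<bullet> (f k - f l))))
        = 2 * (\<Sum>l\<in>UNIV. \<Sum>k\<in>UNIV. a l k * ((u t k - u t l) \<bullet> (f k - f l)))"
      unfolding sum_distrib_left by (intro sum.cong refl) simp
    ultimately show ?thesis by simp
  qed
  ultimately show ?thesis by simp
qed

text \<open>
  On the given region energy and dissipation bound each other up to constants, and the dissipation is the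
  rate of loss of energy; so both decay exponentially. The velocity is then integrable, which gives a limit
  for every component. The limits coincide and have modulus \<open>sqrt \<mu>\<close> because at each time all
  components are within a multiple of \<open>exp (- \<gamma> t)\<close> of a common point of that modulus.
\<close>

theorem exponential_convergence:
  assumes u: "\<And>t l. 0 \<le> t \<Longrightarrow> ((\<lambda>s. u s l) has_vector_derivative field (u t) l) (at t within {0..})"
    and "0 < m" and bounds: "\<And>t l. 0 \<le> t \<Longrightarrow> m \<le> Re (u t l) \<and> cmod (u t l) \<le> M"
  obtains v C \<gamma> where "C > 0" and "\<gamma> > 0" and "cmod v = sqrt \<mu>"
    and "\<And>t l. 0 \<le> t \<Longrightarrow> cmod (field (u t) l) \<le> C * exp (- \<gamma> * t)"
    and "\<And>t l. 0 \<le> t \<Longrightarrow> cmod (u t l - v) \<le> C * exp (- \<gamma> * t)"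
proof -
  obtain C1 where C1: "C1 > 0" "\<And>u. (\<And>l. m \<le> Re (u l) \<and> cmod (u l) \<le> M) \<Longrightarrow>
      \<exists>v. cmod v = sqrt \<mu> \<and> (\<forall>l. (cmod (u l - v))\<^sup>2 \<le> C1 * dissipation u)"
    using distance_to_equilibrium_bound[OF \<open>0 < m\<close>] by metis
  define A where "A = (\<Sum>l\<in>UNIV. \<Sum>k\<in>UNIV. a l k)"
  have A: "0 \<le> A" unfolding A_def by (intro sum_nonneg nonneg)
  have "M > 0" using bounds[of 0 undefined] \<open>0 < m\<close> complex_Re_le_cmod[of "u 0 undefined"] by linarith
  define C2 where "C2 = (CARD('n) * (M + sqrt \<mu>)\<^sup>2 / 4 + c * A) * C1"
  define C3 where "C3 = 8 * M\<^sup>2 + 8 * c * A"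
  have "0 < (M + sqrt \<mu>)\<^sup>2" using \<open>M > 0\<close> \<mu> by (intro zero_less_power add_pos_pos) auto
  then have C2: "C2 > 0" unfolding C2_def using C1 c A
    by (intro mult_pos_pos add_pos_nonneg divide_pos_pos) auto
  have C3: "C3 > 0" unfolding C3_def using c A \<open>M > 0\<close> by (intro add_pos_nonneg) auto
  \<comment> \<open>the energy decays at rate \<open>1 / C2\<close>, distances like its square root\<close>
  define \<gamma> where "\<gamma> = 1 / (2 * C2)"
  have \<gamma>: "\<gamma> > 0" using C2 by (simp add: \<gamma>_def)
  have E: "energy (u t) \<le> energy (u 0) * exp (- (1 / C2) * t)" if "0 \<le> t" for t
  proof (rule gronwall_differential[OF that])
    fix s assume "s \<in> {0..t}"
    then have s: "0 \<le> s" by simp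
    show "((\<lambda>s. energy (u s)) has_real_derivative - dissipation (u s)) (at s within {0..t})"
      by (rule has_field_derivative_subset[OF energy_has_derivative[OF u[OF s]]]) auto
    obtain v where "cmod v = sqrt \<mu>" "\<And>l. (cmod (u s l - v))\<^sup>2 \<le> C1 * dissipation (u s)"
      using C1(2)[of "u s"] bounds[OF s] by blast
    from energy_le_distance[of "u s" M v, OF _ this] bounds[OF s]
    have "energy (u s) \<le> C2 * dissipation (u s)"
      by (simp add: C2_def A_def mult.assoc)
    then show "- dissipation (u s) \<le> - (1 / C2) * energy (u s)"
      using C2 by (simp add: field_simps)
  qed
  define E0 where "E0 = energy (u 0)"
  have E0: "E0 \<ge> 0" by (simp add: E0_def energy_nonneg)
  have diss: "dissipation (u t) \<le> C3 * E0 * (exp (- \<gamma> * t))\<^sup>2" if "0 \<le> t" for t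
  proof -
    have "dissipation (u t) \<le> C3 * energy (u t)"
      unfolding C3_def A_def by (rule dissipation_le_energy) (use bounds[OF that] in auto)
    also have "\<dots> \<le> C3 * (E0 * exp (- (1 / C2) * t))"
      unfolding E0_def using C3 by (intro mult_left_mono E that) auto
    also have "exp (- (1 / C2) * t) = (exp (- \<gamma> * t))\<^sup>2"
      by (simp add: exp_double[symmetric] \<gamma>_def)
    finally show ?thesis by (simp add: mult.assoc)
  qed
  define B where "B = sqrt (C3 * E0) + sqrt (C1 * (C3 * E0)) + 1"
  have B: "sqrt (C3 * E0) \<le> B" "sqrt (C1 * (C3 * E0)) \<le> B" "B > 0"
    using C1 C3 E0 by (auto simp: B_def intro!: add_nonneg_pos add_nonneg_nonneg)
  have root: "x \<le> B * exp (- \<gamma> * t)" if "x\<^sup>2 \<le> K * (exp (- \<gamma> * t))\<^sup>2" "sqrt K \<le> B" for x K t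
  proof -
    have "x \<le> sqrt (K * (exp (- \<gamma> * t))\<^sup>2)" using that(1) by (rule real_le_rsqrt)
    also have "\<dots> = sqrt K * exp (- \<gamma> * t)" by (simp add: real_sqrt_mult)
    also have "\<dots> \<le> B * exp (- \<gamma> * t)" using that(2) by (intro mult_right_mono) auto
    finally show ?thesis .
  qed
  have speed: "cmod (field (u t) l) \<le> B * exp (- \<gamma> * t)" if "0 \<le> t" for t l
    by (rule root[OF _ B(1)]) (rule order_trans[OF cmod_field_le diss[OF that]])
  have near: "\<exists>v. cmod v = sqrt \<mu> \<and> (\<forall>l. cmod (u t l - v) \<le> B * exp (- \<gamma> * t))" if t: "0 \<le> t" for t
  proof -
    obtain v where v: "cmod v = sqrt \<mu>" "\<And>l. (cmod (u t l - v))\<^sup>2 \<le> C1 * dissipation (u t)"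
      using C1(2)[of "u t"] bounds[OF t] by blast
    have "C1 * dissipation (u t) \<le> C1 * (C3 * E0) * (exp (- \<gamma> * t))\<^sup>2"
      using mult_left_mono[OF diss[OF t], of C1] C1 by (simp add: mult.assoc)
    then have "cmod (u t l - v) \<le> B * exp (- \<gamma> * t)" for l
      by (intro root[OF _ B(2)]) (use v(2)[of l] in linarith)
    with v(1) show ?thesis by blast
  qed
  have "\<exists>L. \<forall>t\<ge>0. cmod (u t l - L) \<le> B / \<gamma> * exp (- \<gamma> * t)" for l
    using exponential_tail_bound[of "\<lambda>t. u t l" "\<lambda>t. field (u t) l" B \<gamma>, OF u speed \<gamma>] by blast
  then obtain L where L: "\<And>l t. 0 \<le> t \<Longrightarrow> cmod (u t l - L l) \<le> B / \<gamma> * exp (- \<gamma> * t)"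
    by metis
  have key: "\<exists>v. cmod v = sqrt \<mu> \<and> (\<forall>l. cmod (L l - v) \<le> (B / \<gamma> + B) * exp (- \<gamma> * t))" if t: "0 \<le> t" for t
  proof -
    obtain v where v: "cmod v = sqrt \<mu>" "\<And>l. cmod (u t l - v) \<le> B * exp (- \<gamma> * t)"
      using near[OF t] by blast
    have "cmod (L l - v) \<le> (B / \<gamma> + B) * exp (- \<gamma> * t)" for l
      using norm_triangle_ineq[of "L l - u t l" "u t l - v"] L[OF t, of l] v(2)[of l]
      by (simp add: norm_minus_commute algebra_simps)
    with v(1) show ?thesis by blast
  qed
  have same: "L l = L k" for l k
  proof -
    have "cmod (L l - L k) \<le> (2 * (B / \<gamma> + B)) * exp (- \<gamma> * t)" if t: "0 \<le> t" for t
    proof -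
      obtain v where "\<And>l. cmod (L l - v) \<le> (B / \<gamma> + B) * exp (- \<gamma> * t)"
        using key[OF t] by blast
      from this[of l] this[of k] norm_triangle_ineq4[of "L l - v" "L k - v"] show ?thesis
        unfolding mult.assoc by simp
    qed
    from nonpos_if_le_exponential_decay[OF this \<gamma>] show ?thesis by simp
  qed
  define v where "v = L undefined"
  have "cmod v = sqrt \<mu>"
  proof -
    have "\<bar>cmod v - sqrt \<mu>\<bar> \<le> (B / \<gamma> + B) * exp (- \<gamma> * t)" if t: "0 \<le> t" for t
    proof -
      obtain w where "cmod w = sqrt \<mu>" "cmod (v - w) \<le> (B / \<gamma> + B) * exp (- \<gamma> * t)"
        using key[OF t] unfolding v_def by blast
      with norm_triangle_ineq3[of v w] show ?thesis by simp
    qed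
    from nonpos_if_le_exponential_decay[OF this \<gamma>] show ?thesis by simp
  qed
  moreover have "cmod (field (u t) l) \<le> (B / \<gamma> + B) * exp (- \<gamma> * t)" if "0 \<le> t" for t l
    using speed[OF that, of l] B(3) \<gamma> by (simp add: distrib_right add_increasing)
  moreover have "cmod (u t l - v) \<le> (B / \<gamma> + B) * exp (- \<gamma> * t)" if "0 \<le> t" for t l
    using L[OF that, of l] same[of l undefined] B(3) by (simp add: v_def distrib_right add_increasing2)
  moreover have "B / \<gamma> + B > 0" using B(3) \<gamma> by (simp add: add_pos_pos)
  ultimately show ?thesis using that[of "B / \<gamma> + B" \<gamma> v] \<gamma> by blast
qed

end

section \<open>Invariant regions\<close>

context symmetric_weights
begin

text \<open>
  Applied to a linear functional of the oscillators, this is invariance of a half-plane.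
\<close>

lemma nonnegativity_preserved:
  fixes w \<kappa> :: "'n \<Rightarrow> real \<Rightarrow> real"
  assumes deriv: "\<And>l t. 0 \<le> t \<Longrightarrow> (w l has_real_derivative
      \<kappa> l t * w l t + c * (\<Sum>k\<in>UNIV. a l k * (w k t - w l t))) (at t within {0..})"
    and \<kappa>: "\<And>l t. 0 \<le> t \<Longrightarrow> \<kappa> l t \<le> K"
    and "0 \<le> c" and init: "\<And>l. 0 \<le> w l 0" and "0 \<le> t"
  shows "0 \<le> w l t"
proof -
  have "- w l t \<le> 0"
  proof (rule network_maximum_principle[OF _ _ \<open>0 \<le> c\<close> _ \<open>0 \<le> t\<close>])
    fix l and t :: real assume t: "0 \<le> t"
    show "((\<lambda>t. - w l t) has_real_derivative
        - (\<kappa> l t * w l t + c * (\<Sum>k\<in>UNIV. a l k * (w k t - w l t)))) (at t within {0..})"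
      by (rule DERIV_minus[OF deriv[OF t]])
    assume "0 < - w l t"
    then have "\<kappa> l t * (- w l t) \<le> K * (- w l t)"
      by (intro mult_right_mono \<kappa>[OF t]) auto
    moreover have "(\<Sum>k\<in>UNIV. a l k * (- w k t - - w l t)) = - (\<Sum>k\<in>UNIV. a l k * (w k t - w l t))"
      by (simp add: sum_negf[symmetric] algebra_simps)
    ultimately show "- (\<kappa> l t * w l t + c * (\<Sum>k\<in>UNIV. a l k * (w k t - w l t)))
        \<le> K * (- w l t) + c * (\<Sum>k\<in>UNIV. a l k * (- w k t - - w l t))"
      by simp
  qed (use init in auto)
  then show ?thesis by simp
qed

text \<open>
  The coupling pulls the smallest component up, so only the sign of the growth rate below the level \<open>m\<close>
  matters.
\<close>

lemma lower_bound_preserved: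
  fixes w \<kappa> :: "'n \<Rightarrow> real \<Rightarrow> real"
  assumes deriv: "\<And>l t. 0 \<le> t \<Longrightarrow> (w l has_real_derivative
      \<kappa> l t * w l t + c * (\<Sum>k\<in>UNIV. a l k * (w k t - w l t))) (at t within {0..})"
    and nonneg: "\<And>l t. 0 \<le> t \<Longrightarrow> 0 \<le> w l t"
    and \<kappa>: "\<And>l t. 0 \<le> t \<Longrightarrow> w l t < m \<Longrightarrow> 0 \<le> \<kappa> l t"
    and "0 \<le> c" and init: "\<And>l. m \<le> w l 0" and "0 \<le> t"
  shows "m \<le> w l t"
proof -
  have "m - w l t \<le> 0"
  proof (rule network_maximum_principle[where K = 0, OF _ _ \<open>0 \<le> c\<close> _ \<open>0 \<le> t\<close>])
    fix l and t :: real assume t: "0 \<le> t"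
    show "((\<lambda>t. m - w l t) has_real_derivative
        - (\<kappa> l t * w l t + c * (\<Sum>k\<in>UNIV. a l k * (w k t - w l t)))) (at t within {0..})"
      using DERIV_diff[OF DERIV_const deriv[OF t]] by simp
    assume "0 < m - w l t"
    then have "0 \<le> \<kappa> l t * w l t"
      using \<kappa>[OF t] nonneg[OF t] by simp
    moreover have "(\<Sum>k\<in>UNIV. a l k * (m - w k t - (m - w l t))) = - (\<Sum>k\<in>UNIV. a l k * (w k t - w l t))"
      by (simp add: sum_negf[symmetric] algebra_simps)
    ultimately show "- (\<kappa> l t * w l t + c * (\<Sum>k\<in>UNIV. a l k * (w k t - w l t)))
        \<le> 0 * (m - w l t) + c * (\<Sum>k\<in>UNIV. a l k * (m - w k t - (m - w l t)))"
      by simp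
  qed (use init in auto)
  then show ?thesis by simp
qed

text \<open>
  Since \<open>2 u\<^sub>l \<bullet> (u\<^sub>k - u\<^sub>l) \<le> |u\<^sub>k|\<^sup>2 - |u\<^sub>l|\<^sup>2\<close>, beyond the level \<open>M\<close> the squared norms are
  subsolutions of the scalar diffusion on the network.
\<close>

lemma norm_bound_preserved:
  fixes u :: "real \<Rightarrow> 'n \<Rightarrow> 'v::real_inner"
  assumes deriv: "\<And>l t. 0 \<le> t \<Longrightarrow> ((\<lambda>s. u s l) has_vector_derivative
      \<kappa> l t *\<^sub>R u t l + c *\<^sub>R (\<Sum>k\<in>UNIV. a l k *\<^sub>R (u t k - u t l))) (at t within {0..})"
    and \<kappa>: "\<And>l t. 0 \<le> t \<Longrightarrow> M < norm (u t l) \<Longrightarrow> \<kappa> l t \<le> 0"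
    and "0 \<le> c" and init: "\<And>l. norm (u 0 l) \<le> M" and "0 \<le> t"
  shows "norm (u t l) \<le> M"
proof -
  have "0 \<le> M" using order_trans[OF norm_ge_zero init] .
  have "(norm (u t l))\<^sup>2 - M\<^sup>2 \<le> 0"
  proof (rule network_maximum_principle[where K = 0, OF _ _ \<open>0 \<le> c\<close> _ \<open>0 \<le> t\<close>])
    fix l and t :: real assume t: "0 \<le> t"
    define D where "D = \<kappa> l t *\<^sub>R u t l + c *\<^sub>R (\<Sum>k\<in>UNIV. a l k *\<^sub>R (u t k - u t l))"
    show "((\<lambda>t. (norm (u t l))\<^sup>2 - M\<^sup>2) has_real_derivative 2 * (u t l \<bullet> D)) (at t within {0..})"
      using DERIV_diff[OF norm_square_has_real_derivative[OF deriv[OF t]] DERIV_const]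
      by (simp add: D_def)
    assume "0 < (norm (u t l))\<^sup>2 - M\<^sup>2"
    then have "M < norm (u t l)"
      using \<open>0 \<le> M\<close> by (simp add: power_less_imp_less_base)
    then have "\<kappa> l t * (u t l \<bullet> u t l) \<le> 0"
      by (simp add: \<kappa>[OF t] mult_nonpos_nonneg)
    moreover have "2 * (\<Sum>k\<in>UNIV. a l k * (u t l \<bullet> (u t k - u t l)))
        \<le> (\<Sum>k\<in>UNIV. a l k * ((norm (u t k))\<^sup>2 - M\<^sup>2 - ((norm (u t l))\<^sup>2 - M\<^sup>2)))"
      unfolding sum_distrib_left
    proof (rule sum_mono)
      fix k
      have "0 \<le> (norm (u t k - u t l))\<^sup>2" by simp
      then have "2 * (u t l \<bullet> (u t k - u t l)) \<le> (norm (u t k))\<^sup>2 - (norm (u t l))\<^sup>2"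
        by (simp add: power2_norm_eq_inner inner_diff_left inner_diff_right inner_commute)
      from mult_left_mono[OF this nonneg[of l k]]
      show "2 * (a l k * (u t l \<bullet> (u t k - u t l)))
          \<le> a l k * ((norm (u t k))\<^sup>2 - M\<^sup>2 - ((norm (u t l))\<^sup>2 - M\<^sup>2))"
        by simp
    qed
    then have "c * (2 * (\<Sum>k\<in>UNIV. a l k * (u t l \<bullet> (u t k - u t l))))
        \<le> c * (\<Sum>k\<in>UNIV. a l k * ((norm (u t k))\<^sup>2 - M\<^sup>2 - ((norm (u t l))\<^sup>2 - M\<^sup>2)))"
      using \<open>0 \<le> c\<close> by (intro mult_left_mono)
    ultimately show "2 * (u t l \<bullet> D) \<le> 0 * ((norm (u t l))\<^sup>2 - M\<^sup>2)
        + c * (\<Sum>k\<in>UNIV. a l k * ((norm (u t k))\<^sup>2 - M\<^sup>2 - ((norm (u t l))\<^sup>2 - M\<^sup>2)))"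
      by (simp add: D_def inner_add_right inner_sum_right)
  next
    show "(norm (u 0 l))\<^sup>2 - M\<^sup>2 \<le> 0" for l
      using power_mono[OF init norm_ge_zero, of l 2] by simp
  qed
  then show ?thesis
    by (intro power2_le_imp_le[OF _ \<open>0 \<le> M\<close>]) simp
qed

end

section \<open>Global solutions\<close>

text \<open>
  For the ordered pair \<open>|w| \<le> |v|\<close>, the factors \<open>min (|v|, M)\<^sup>2\<close> and \<open>min (|w|, M)\<^sup>2\<close> differ only when
  \<open>|w| < M\<close>, and then the vector \<open>w\<close> that this difference multiplies is bounded by \<open>M\<close>.
\<close>

lemma truncated_cubic_Lipschitz:
  fixes v w :: "'v::real_normed_vector"
  assumes "0 \<le> M"
  shows "norm (min ((norm v)\<^sup>2) (M\<^sup>2) *\<^sub>R v - min ((norm w)\<^sup>2) (M\<^sup>2) *\<^sub>R w) \<le> 3 * M\<^sup>2 * norm (v - w)"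
proof -
  have *: "norm (min ((norm v)\<^sup>2) (M\<^sup>2) *\<^sub>R v - min ((norm w)\<^sup>2) (M\<^sup>2) *\<^sub>R w) \<le> 3 * M\<^sup>2 * norm (v - w)"
    if le: "norm w \<le> norm v" for v w :: 'v
  proof -
    define p where "p x = min (norm x) M" for x :: 'v
    have p: "min ((norm x)\<^sup>2) (M\<^sup>2) = (p x)\<^sup>2" for x :: 'v
    proof (cases "norm x \<le> M")
      case True
      then show ?thesis using power_mono[OF True, of 2] by (simp add: p_def)
    next
      case False
      then show ?thesis using power_mono[of M "norm x" 2] \<open>0 \<le> M\<close> by (simp add: p_def)
    qed
    have p0: "0 \<le> p x" "p x \<le> M" for x :: 'v using \<open>0 \<le> M\<close> by (auto simp: p_def)
    have "p w \<le> p v" using le by (auto simp: p_def)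
    have diff: "(p v - p w) * norm w \<le> norm (v - w) * M"
    proof (cases "norm w \<le> M")
      case True
      have "p v - p w \<le> norm (v - w)"
        using True norm_triangle_ineq2[of v w] by (simp add: p_def)
      then show ?thesis using True by (intro mult_mono) auto
    next
      case False
      then show ?thesis using le \<open>0 \<le> M\<close> by (simp add: p_def)
    qed
    have "norm ((p v)\<^sup>2 *\<^sub>R v - (p w)\<^sup>2 *\<^sub>R w) = norm ((p v)\<^sup>2 *\<^sub>R (v - w) + ((p v)\<^sup>2 - (p w)\<^sup>2) *\<^sub>R w)"
      by (simp add: algebra_simps)
    also have "\<dots> \<le> (p v)\<^sup>2 * norm (v - w) + \<bar>(p v)\<^sup>2 - (p w)\<^sup>2\<bar> * norm w"
      by (rule order_trans[OF norm_triangle_ineq]) simp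
    also have "\<bar>(p v)\<^sup>2 - (p w)\<^sup>2\<bar> * norm w = (p v + p w) * ((p v - p w) * norm w)"
    proof -
      have "(p v)\<^sup>2 - (p w)\<^sup>2 = (p v + p w) * (p v - p w)"
        by (simp add: power2_eq_square algebra_simps)
      moreover have "0 \<le> (p v + p w) * (p v - p w)"
        using p0 \<open>p w \<le> p v\<close> by (intro mult_nonneg_nonneg add_nonneg_nonneg) auto
      ultimately show ?thesis by simp
    qed
    also have "(p v)\<^sup>2 * norm (v - w) + (p v + p w) * ((p v - p w) * norm w)
        \<le> M\<^sup>2 * norm (v - w) + (M + M) * (norm (v - w) * M)"
      using p0 \<open>p w \<le> p v\<close> \<open>0 \<le> M\<close>
      by (intro add_mono mult_mono diff power_mono order_refl) (auto intro: add_nonneg_nonneg)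
    also have "\<dots> = 3 * M\<^sup>2 * norm (v - w)" by (simp add: power2_eq_square algebra_simps)
    finally show ?thesis by (simp add: p)
  qed
  show ?thesis
  proof (cases "norm w \<le> norm v")
    case False
    then show ?thesis using *[of v w] by (simp add: norm_minus_commute)
  qed (rule *)
qed

context oscillator_network
begin

text \<open>
  It agrees with \<open>field\<close> as long as all moduli are at most \<open>M\<close>.
\<close>

definition truncated_field :: "real \<Rightarrow> complex ^ 'n \<Rightarrow> complex ^ 'n" where
  "truncated_field M w = (\<chi> l. (\<mu> - min ((cmod (w $ l))\<^sup>2) (M\<^sup>2)) *\<^sub>R w $ l
     + c *\<^sub>R (\<Sum>k\<in>UNIV. a l k *\<^sub>R (w $ k - w $ l)))"

lemma truncated_field_Lipschitz:
  assumes "0 \<le> M"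
  obtains L where "L > 0"
    and "\<And>v w. norm (truncated_field M v - truncated_field M w) \<le> L * norm (v - w)"
proof -
  define B where "B = (\<Sum>l\<in>UNIV. \<mu> + 3 * M\<^sup>2 + c * (\<Sum>k\<in>UNIV. a l k * 2))"
  have "norm (truncated_field M v - truncated_field M w) \<le> B * norm (v - w)" for v w
  proof -
    define d where "d = v - w"
    have d: "cmod (d $ l) \<le> norm d" for l by (rule Finite_Cartesian_Product.norm_nth_le)
    have "cmod ((truncated_field M v - truncated_field M w) $ l)
        \<le> (\<mu> + 3 * M\<^sup>2 + c * (\<Sum>k\<in>UNIV. a l k * 2)) * norm d" for l
    proof -
      define e where "e = min ((cmod (v $ l))\<^sup>2) (M\<^sup>2) *\<^sub>R v $ l - min ((cmod (w $ l))\<^sup>2) (M\<^sup>2) *\<^sub>R w $ l"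
      define S where "S = (\<Sum>k\<in>UNIV. a l k *\<^sub>R (d $ k - d $ l))"
      have "(truncated_field M v - truncated_field M w) $ l = \<mu> *\<^sub>R d $ l - e + c *\<^sub>R S"
      proof -
        have "S = (\<Sum>k\<in>UNIV. a l k *\<^sub>R (v $ k - v $ l)) - (\<Sum>k\<in>UNIV. a l k *\<^sub>R (w $ k - w $ l))"
          unfolding S_def sum_subtractf[symmetric]
          by (intro sum.cong refl) (simp add: d_def algebra_simps)
        then show ?thesis
          by (simp only: truncated_field_def vec_lambda_beta vector_minus_component d_def e_def)
            (simp add: algebra_simps)
      qed
      also have "cmod \<dots> \<le> \<mu> * cmod (d $ l) + cmod e + c * cmod S"
        using norm_triangle_ineq[of "\<mu> *\<^sub>R d $ l - e" "c *\<^sub>R S"]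
          norm_triangle_ineq4[of "\<mu> *\<^sub>R d $ l" e] c \<mu> by simp
      also have "\<dots> \<le> \<mu> * norm d + 3 * M\<^sup>2 * norm d + c * ((\<Sum>k\<in>UNIV. a l k * 2) * norm d)"
      proof (intro add_mono mult_left_mono d)
        have "cmod e \<le> 3 * M\<^sup>2 * cmod (v $ l - w $ l)"
          unfolding e_def by (rule truncated_cubic_Lipschitz[OF assms])
        also have "\<dots> \<le> 3 * M\<^sup>2 * norm d"
          using d[of l] by (intro mult_left_mono) (auto simp: d_def)
        finally show "cmod e \<le> 3 * M\<^sup>2 * norm d" .
        have "cmod S \<le> (\<Sum>k\<in>UNIV. a l k * (2 * norm d))"
          unfolding S_def
        proof (rule sum_norm_le)
          fix k
          have "cmod (d $ k - d $ l) \<le> 2 * norm d"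
            using norm_triangle_ineq4[of "d $ k" "d $ l"] d[of k] d[of l] by linarith
          then show "cmod (a l k *\<^sub>R (d $ k - d $ l)) \<le> a l k * (2 * norm d)"
            using nonneg[of l k] by (simp add: mult_left_mono)
        qed
        also have "\<dots> = (\<Sum>k\<in>UNIV. a l k * 2) * norm d" by (simp add: sum_distrib_right mult.assoc)
        finally show "cmod S \<le> (\<Sum>k\<in>UNIV. a l k * 2) * norm d" .
      qed (use c \<mu> in auto)
      finally show ?thesis by (simp only: distrib_right mult.assoc)
    qed
    then have "(\<Sum>l\<in>UNIV. cmod ((truncated_field M v - truncated_field M w) $ l)) \<le> B * norm d"
      unfolding B_def sum_distrib_right by (rule sum_mono)
    moreover have "norm (truncated_field M v - truncated_field M w)
        \<le> (\<Sum>l\<in>UNIV. cmod ((truncated_field M v - truncated_field M w) $ l))"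
      unfolding norm_vec_def by (rule L2_set_le_sum) simp
    ultimately show ?thesis by (simp add: d_def)
  qed
  moreover have "B * norm x \<le> (\<bar>B\<bar> + 1) * norm x" for x :: "complex ^ 'n"
    by (intro mult_right_mono) auto
  ultimately show ?thesis
    by (intro that[of "\<bar>B\<bar> + 1"]) (auto intro: order_trans)
qed

text \<open>
  The growth rates and the coupling weights are real, so every real linear functional of the components
  obeys the same linear network equation with coefficients frozen along the solution.
\<close>

lemma field_functional:
  "\<alpha> * Re (field u l) + \<beta> * Im (field u l) = (\<mu> - (cmod (u l))\<^sup>2) * (\<alpha> * Re (u l) + \<beta> * Im (u l))
     + c * (\<Sum>k\<in>UNIV. a l k * ((\<alpha> * Re (u k) + \<beta> * Im (u k)) - (\<alpha> * Re (u l) + \<beta> * Im (u l))))"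
proof -
  have "(\<Sum>k\<in>UNIV. a l k * ((\<alpha> * Re (u k) + \<beta> * Im (u k)) - (\<alpha> * Re (u l) + \<beta> * Im (u l))))
      = \<alpha> * (\<Sum>k\<in>UNIV. a l k * (Re (u k) - Re (u l))) + \<beta> * (\<Sum>k\<in>UNIV. a l k * (Im (u k) - Im (u l)))"
    unfolding sum_distrib_left sum.distrib[symmetric]
    by (intro sum.cong refl) (simp add: algebra_simps)
  then show ?thesis unfolding Re_field Im_field by (simp add: algebra_simps)
qed

text \<open>
  The truncation level \<open>M\<close> bounds the initial moduli and satisfies \<open>\<mu> \<le> M\<^sup>2\<close>; hence the truncated growth rate
  is nonpositive beyond \<open>M\<close>, the solution of the truncated system stays below \<open>M\<close> and solves the original
  system. The slopes stay between their initial extremes because the functionals \<open>Q Re u - Im u\<close> and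
  \<open>Im u - q Re u\<close> stay nonnegative. With \<open>Im u \<le> Q Re u\<close> the growth rate is at least
  \<open>\<mu> - (1 + Q\<^sup>2) (Re u)\<^sup>2\<close>, which is nonnegative for \<open>Re u \<le> m\<close>; so \<open>Re u\<close> cannot fall below \<open>m\<close>.
\<close>

theorem global_solution_in_cone:
  fixes u\<^sub>0 :: "'n \<Rightarrow> complex"
  assumes init: "\<And>l. 0 < Re (u\<^sub>0 l)" "\<And>l. 0 < Im (u\<^sub>0 l)"
  obtains u :: "real \<Rightarrow> complex ^ 'n" and m M q where
    "\<And>l. u 0 $ l = u\<^sub>0 l"
    and "\<And>t l. 0 \<le> t \<Longrightarrow>
      ((\<lambda>s. u s $ l) has_vector_derivative field (\<lambda>k. u t $ k) l) (at t within {0..})"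
    and "0 < m" and "0 < q"
    and "\<And>t l. 0 \<le> t \<Longrightarrow> m \<le> Re (u t $ l) \<and> cmod (u t $ l) \<le> M \<and> q * Re (u t $ l) \<le> Im (u t $ l)"
proof -
  define M where "M = sqrt \<mu> + (\<Sum>l\<in>UNIV. cmod (u\<^sub>0 l))"
  have M: "0 \<le> M" "sqrt \<mu> \<le> M" "cmod (u\<^sub>0 l) \<le> M" for l
    using \<mu> member_le_sum[of l UNIV "\<lambda>l. cmod (u\<^sub>0 l)"]
    by (auto simp: M_def intro!: add_nonneg_nonneg sum_nonneg add_increasing)
  have \<mu>M: "\<mu> \<le> M\<^sup>2" using power_mono[OF M(2), of 2] \<mu> by simp
  obtain L where "L > 0" "\<And>v w. norm (truncated_field M v - truncated_field M w) \<le> L * norm (v - w)"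
    using truncated_field_Lipschitz[OF M(1)] by blast
  from global_solution_of_Lipschitz_field[OF this(2,1), of "\<chi> l. u\<^sub>0 l"]
  obtain u where u0: "u 0 = (\<chi> l. u\<^sub>0 l)"
    and du: "\<And>t. 0 \<le> t \<Longrightarrow> (u has_vector_derivative truncated_field M (u t)) (at t within {0..})"
    by blast
  have dtrunc: "((\<lambda>s. u s $ l) has_vector_derivative
      (\<mu> - min ((cmod (u t $ l))\<^sup>2) (M\<^sup>2)) *\<^sub>R u t $ l
        + c *\<^sub>R (\<Sum>k\<in>UNIV. a l k *\<^sub>R (u t $ k - u t $ l))) (at t within {0..})"
    if "0 \<le> t" for t l
    using bounded_linear.has_vector_derivative[OF bounded_linear_vec_nth du[OF that], of l]
    by (simp add: truncated_field_def)
  have bound: "cmod (u t $ l) \<le> M" if "0 \<le> t" for t l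
  proof (rule norm_bound_preserved[where u = "\<lambda>t l. u t $ l"
        and \<kappa> = "\<lambda>l t. \<mu> - min ((cmod (u t $ l))\<^sup>2) (M\<^sup>2)", OF dtrunc])
    show "\<mu> - min ((cmod (u t $ l))\<^sup>2) (M\<^sup>2) \<le> 0" if "M < cmod (u t $ l)" for t l
      using power_mono[of M "cmod (u t $ l)" 2] that M(1) \<mu>M by simp
  qed (use c M(3) u0 that in auto)
  have deriv: "((\<lambda>s. u s $ l) has_vector_derivative field (\<lambda>k. u t $ k) l) (at t within {0..})"
    if "0 \<le> t" for t l
    using dtrunc[OF that, of l] power_mono[OF bound[OF that, of l], of 2] by (simp add: field_def)
  have dlin: "((\<lambda>s. \<alpha> * Re (u s $ l) + \<beta> * Im (u s $ l)) has_real_derivative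
      (\<mu> - (cmod (u t $ l))\<^sup>2) * (\<alpha> * Re (u t $ l) + \<beta> * Im (u t $ l))
       + c * (\<Sum>k\<in>UNIV. a l k * ((\<alpha> * Re (u t $ k) + \<beta> * Im (u t $ k))
           - (\<alpha> * Re (u t $ l) + \<beta> * Im (u t $ l))))) (at t within {0..})"
    if "0 \<le> t" for t l \<alpha> \<beta>
    unfolding field_functional[of \<alpha> "\<lambda>k. u t $ k" l \<beta>, symmetric] has_real_derivative_iff_has_vector_derivative
    by (rule derivative_eq_intros bounded_linear.has_vector_derivative[OF bounded_linear_Re deriv[OF that]]
        bounded_linear.has_vector_derivative[OF bounded_linear_Im deriv[OF that]] refl | simp)+
  have cone: "0 \<le> \<alpha> * Re (u t $ l) + \<beta> * Im (u t $ l)"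
    if "\<And>l. 0 \<le> \<alpha> * Re (u\<^sub>0 l) + \<beta> * Im (u\<^sub>0 l)" "0 \<le> t" for \<alpha> \<beta> t l
    by (rule nonnegativity_preserved[where w = "\<lambda>l t. \<alpha> * Re (u t $ l) + \<beta> * Im (u t $ l)"
          and \<kappa> = "\<lambda>l t. \<mu> - (cmod (u t $ l))\<^sup>2" and K = \<mu>, OF dlin])
      (use that c u0 in auto)
  define Q where "Q = (\<Sum>l\<in>UNIV. Im (u\<^sub>0 l) / Re (u\<^sub>0 l))"
  define q where "q = Min (range (\<lambda>l. Im (u\<^sub>0 l) / Re (u\<^sub>0 l)))"
  define m where "m = min (Min (range (\<lambda>l. Re (u\<^sub>0 l)))) (sqrt (\<mu> / (1 + Q\<^sup>2)))"
  have Q1: "1 + Q\<^sup>2 > 0" by (simp add: add_pos_nonneg)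
  have "m > 0" unfolding m_def using init \<mu> Q1 by simp
  have "q > 0" unfolding q_def using init by simp
  have Re0: "0 \<le> Re (u t $ l)" if "0 \<le> t" for t l
    using cone[of 1 0 t l] that less_imp_le[OF init(1)] by simp
  have Im0: "0 \<le> Im (u t $ l)" if "0 \<le> t" for t l
    using cone[of 0 1 t l] that less_imp_le[OF init(2)] by simp
  have upper: "Im (u t $ l) \<le> Q * Re (u t $ l)" if "0 \<le> t" for t l
  proof -
    have "Im (u\<^sub>0 l) \<le> Q * Re (u\<^sub>0 l)" for l
    proof -
      have "Im (u\<^sub>0 l) / Re (u\<^sub>0 l) \<le> Q"
        unfolding Q_def by (rule member_le_sum) (auto intro: divide_nonneg_nonneg less_imp_le init)
      then show ?thesis using init(1)[of l] by (simp add: field_simps)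
    qed
    then show ?thesis using cone[of Q "-1" t l] that by simp
  qed
  have lower: "q * Re (u t $ l) \<le> Im (u t $ l)" if "0 \<le> t" for t l
  proof -
    have "q * Re (u\<^sub>0 l) \<le> Im (u\<^sub>0 l)" for l
    proof -
      have "q \<le> Im (u\<^sub>0 l) / Re (u\<^sub>0 l)" unfolding q_def by (rule Min_le) auto
      then show ?thesis using init(1)[of l] by (simp add: field_simps)
    qed
    then show ?thesis using cone[of "-q" 1 t l] that by simp
  qed
  have "m \<le> 1 * Re (u t $ l) + 0 * Im (u t $ l)" if "0 \<le> t" for t l
  proof (rule lower_bound_preserved[where w = "\<lambda>l t. 1 * Re (u t $ l) + 0 * Im (u t $ l)"
        and \<kappa> = "\<lambda>l t. \<mu> - (cmod (u t $ l))\<^sup>2", OF dlin])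
    fix l and t :: real assume t: "0 \<le> t"
    show "0 \<le> 1 * Re (u t $ l) + 0 * Im (u t $ l)" using Re0[OF t] by simp
    assume "1 * Re (u t $ l) + 0 * Im (u t $ l) < m"
    then have "Re (u t $ l) \<le> sqrt (\<mu> / (1 + Q\<^sup>2))" by (simp add: m_def)
    then have "(Re (u t $ l))\<^sup>2 \<le> \<mu> / (1 + Q\<^sup>2)"
      using Re0[OF t, of l] power_mono[of "Re (u t $ l)" "sqrt (\<mu> / (1 + Q\<^sup>2))" 2] \<mu> Q1 by simp
    then have "(1 + Q\<^sup>2) * (Re (u t $ l))\<^sup>2 \<le> \<mu>" using Q1 by (simp add: field_simps)
    moreover have "(Im (u t $ l))\<^sup>2 \<le> (Q * Re (u t $ l))\<^sup>2"
      by (intro power_mono upper Im0 t)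
    ultimately show "0 \<le> \<mu> - (cmod (u t $ l))\<^sup>2"
      by (simp add: cmod_power2 power_mult_distrib algebra_simps)
  next
    show "m \<le> 1 * Re (u 0 $ l) + 0 * Im (u 0 $ l)" for l
      by (simp add: u0 m_def min.coboundedI1)
  qed (use c that in auto)
  then have "m \<le> Re (u t $ l) \<and> cmod (u t $ l) \<le> M \<and> q * Re (u t $ l) \<le> Im (u t $ l)" if "0 \<le> t" for t l
    using that bound[OF that] lower[OF that] by simp
  with \<open>m > 0\<close> \<open>q > 0\<close> deriv show ?thesis
    by (intro that[of u m q M]) (simp_all add: u0)
qed

end

section \<open>Exponential convergence of real quantities\<close>

lemma exp_tendstoI:
  assumes "\<And>t. 0 \<le> t \<Longrightarrow> dist (q t) L \<le> C * exp (- \<gamma> * t)" and "0 < \<gamma>"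
  shows "exp_tendsto q L"
proof -
  have "dist (q t) L \<le> (\<bar>C\<bar> + 1) * exp (- \<gamma> * t)" if "0 \<le> t" for t
    by (rule order_trans[OF assms(1)[OF that]]) (intro mult_right_mono, auto)
  then show ?thesis
    unfolding exp_tendsto_def using \<open>0 < \<gamma>\<close>
    by (intro exI[of _ "\<bar>C\<bar> + 1"] exI[of _ \<gamma>] conjI) auto
qed

lemma exp_tendsto_imp_tendsto:
  assumes "exp_tendsto q L"
  shows "(q \<longlongrightarrow> L) at_top"
proof -
  obtain C \<gamma> where C: "\<gamma> > 0" "\<And>t. 0 \<le> t \<Longrightarrow> dist (q t) L \<le> C * exp (- \<gamma> * t)"
    using assms by (auto simp: exp_tendsto_def)
  have lim: "((\<lambda>t. C * exp (- \<gamma> * t)) \<longlongrightarrow> 0) at_top"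
    using C(1) by real_asymp
  have "((\<lambda>t. dist (q t) L) \<longlongrightarrow> 0) at_top"
  proof (rule tendsto_sandwich[OF _ _ tendsto_const lim])
    show "\<forall>\<^sub>F t in at_top. dist (q t) L \<le> C * exp (- \<gamma> * t)"
      using eventually_ge_at_top[of 0] by eventually_elim (rule C(2))
  qed simp
  then show ?thesis by (rule tendsto_dist_iff[THEN iffD2])
qed

lemma exp_tendsto_abs_diff:
  fixes f g :: "real \<Rightarrow> real"
  assumes "exp_tendsto f a" and "exp_tendsto g a"
  shows "exp_tendsto (\<lambda>t. \<bar>f t - g t\<bar>) 0"
proof -
  obtain C \<gamma> where C: "\<gamma> > 0" "C > 0" "\<And>t. 0 \<le> t \<Longrightarrow> dist (f t) a \<le> C * exp (- \<gamma> * t)"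
    using assms(1) by (auto simp: exp_tendsto_def)
  obtain D \<delta> where D: "\<delta> > 0" "D > 0" "\<And>t. 0 \<le> t \<Longrightarrow> dist (g t) a \<le> D * exp (- \<delta> * t)"
    using assms(2) by (auto simp: exp_tendsto_def)
  show ?thesis
  proof (rule exp_tendstoI)
    show "0 < min \<gamma> \<delta>" using C D by simp
    fix t :: real assume t: "0 \<le> t"
    have "\<bar>f t - g t\<bar> \<le> C * exp (- \<gamma> * t) + D * exp (- \<delta> * t)"
      using C(3)[OF t] D(3)[OF t] by (simp add: dist_real_def)
    also have "\<dots> \<le> C * exp (- min \<gamma> \<delta> * t) + D * exp (- min \<gamma> \<delta> * t)"
      using C D t by (intro add_mono mult_left_mono) (auto intro: mult_right_mono)
    finally show "dist \<bar>f t - g t\<bar> 0 \<le> (C + D) * exp (- min \<gamma> \<delta> * t)"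
      by (simp add: distrib_right)
  qed
qed

lemma dist_S1_le: "dist_S1 \<alpha> \<beta> \<le> \<bar>\<alpha> - \<beta>\<bar>"
proof -
  have "bdd_below (range (\<lambda>m::int. \<bar>\<alpha> - \<beta> + 2 * pi * of_int m\<bar>))"
    by (rule bdd_belowI[of _ 0]) auto
  from cINF_lower[OF this, of 0] show ?thesis by (simp add: dist_S1_def)
qed

lemma dist_S1_nonneg: "0 \<le> dist_S1 \<alpha> \<beta>"
  unfolding dist_S1_def by (rule cINF_greatest) auto

lemma exp_tendsto_dist_S1:
  assumes "exp_tendsto (\<lambda>t. \<bar>f t - g t\<bar>) 0"
  shows "exp_tendsto (\<lambda>t. dist_S1 (f t) (g t)) 0"
proof -
  obtain C \<gamma> where C: "\<gamma> > 0" "\<And>t. 0 \<le> t \<Longrightarrow> \<bar>f t - g t\<bar> \<le> C * exp (- \<gamma> * t)"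
    using assms by (auto simp: exp_tendsto_def)
  show ?thesis
  proof (rule exp_tendstoI[OF _ C(1)])
    fix t :: real assume "0 \<le> t"
    from order_trans[OF dist_S1_le C(2)[OF this]]
    show "dist (dist_S1 (f t) (g t)) 0 \<le> C * exp (- \<gamma> * t)"
      by (simp add: dist_S1_nonneg)
  qed
qed

section \<open>Polar coordinates\<close>

text \<open>
  Two unwrapped angles differ by a continuous function with values in \<open>2 \<pi> \<int>\<close>, which is constant.
\<close>

lemma unwrapped_angle_unique:
  assumes \<theta>: "unwrapped_angle z \<theta>" and \<psi>: "unwrapped_angle z \<psi>"
    and nz: "\<And>t. 0 \<le> t \<Longrightarrow> z t \<noteq> 0" and init: "\<theta> 0 = \<psi> 0" and "0 \<le> t"
  shows "\<theta> t = \<psi> t"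
proof -
  define \<delta> where "\<delta> t = (\<theta> t - \<psi> t) / (2 * pi)" for t
  have int: "\<delta> t \<in> \<int>" if "0 \<le> t" for t
  proof -
    have "exp (\<i> * of_real (\<theta> t)) = exp (\<i> * of_real (\<psi> t))"
    proof -
      have "of_real (cmod (z t)) * exp (\<i> * of_real (\<theta> t)) = of_real (cmod (z t)) * exp (\<i> * of_real (\<psi> t))"
        using \<theta> \<psi> that unfolding unwrapped_angle_def by metis
      then show ?thesis using nz[OF that] by simp
    qed
    then obtain n :: int where "\<i> * of_real (\<theta> t) = \<i> * of_real (\<psi> t) + (of_int (2 * n) * pi) * \<i>"
      unfolding exp_eq by blast
    then have "\<theta> t = \<psi> t + 2 * of_int n * pi"
      by (simp add: complex_eq_iff)
    then have "\<delta> t = of_int n" by (simp add: \<delta>_def)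
    then show ?thesis by simp
  qed
  have "\<delta> constant_on {0..}"
  proof (rule continuous_discrete_range_constant)
    show "continuous_on {0..} \<delta>"
      using \<theta> \<psi> unfolding \<delta>_def unwrapped_angle_def by (auto intro!: continuous_intros)
    fix x :: real assume "x \<in> {0..}"
    then have "1 \<le> norm (\<delta> y - \<delta> x)" if "y \<in> {0..}" "\<delta> y \<noteq> \<delta> x" for y
      using int[of x] int[of y] that Ints_nonzero_abs_ge1[of "\<delta> y - \<delta> x"] by simp
    then show "\<exists>e>0. \<forall>y. y \<in> {0..} \<and> \<delta> y \<noteq> \<delta> x \<longrightarrow> e \<le> norm (\<delta> y - \<delta> x)"
      by (intro exI[of _ 1]) auto
  qed auto
  then have "\<delta> t = \<delta> 0" using \<open>0 \<le> t\<close> by (auto simp: constant_on_def)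
  then show ?thesis using init by (simp add: \<delta>_def)
qed

lemma time_deriv_eq:
  assumes "0 \<le> t" and "(f has_vector_derivative f') (at t within {0..})"
  shows "time_deriv f t = f'"
proof -
  have "at t within {0..} \<noteq> bot"
  proof
    assume "at t within {0..} = bot"
    moreover have "at_right t \<le> at t within {0..}"
      using assms(1) by (intro at_le) auto
    ultimately show False by (simp add: bot_unique)
  qed
  then show ?thesis
    unfolding time_deriv_def by (rule vector_derivative_within) (rule assms(2))
qed

lemma Re_pos_notin_nonpos_Reals: "0 < Re w \<Longrightarrow> w \<notin> \<real>\<^sub>\<le>\<^sub>0"
  by (auto simp: complex_nonpos_Reals_iff)

text \<open>
  One oscillator: a curve \<open>w\<close> in the right half-plane, converging to \<open>v\<close> together with its velocity at an
  exponential rate, and seen in the original frame as \<open>exp (i \<omega> t) w(t)\<close>. In the half-plane the principal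
  argument is a smooth unwrapped angle.
\<close>

locale rotating_convergent_curve =
  fixes w w' :: "real \<Rightarrow> complex" and v :: complex and m C \<gamma> \<omega> :: real
  assumes deriv: "0 \<le> t \<Longrightarrow> (w has_vector_derivative w' t) (at t within {0..})"
    and m: "0 < m" "0 \<le> t \<Longrightarrow> m \<le> Re (w t)" "0 < Re v"
    and decay: "0 \<le> t \<Longrightarrow> cmod (w' t) \<le> C * exp (- \<gamma> * t)"
    and conv: "0 \<le> t \<Longrightarrow> cmod (w t - v) \<le> C * exp (- \<gamma> * t)"
    and \<gamma>: "0 < \<gamma>"
begin

abbreviation z :: "real \<Rightarrow> complex" where
  "z t \<equiv> exp (\<i> * of_real (\<omega> * t)) * w t"

definition phase :: "real \<Rightarrow> real" where
  "phase t = \<omega> * t + Arg (w t)"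

lemma cmod_w_ge: "0 \<le> t \<Longrightarrow> m \<le> cmod (w t)"
  using m(2)[of t] complex_Re_le_cmod[of "w t"] by linarith

lemma w_nonzero: "0 \<le> t \<Longrightarrow> w t \<noteq> 0"
  using cmod_w_ge[of t] m(1) by auto

lemma Ln_deriv:
  assumes "0 \<le> t"
  shows "((\<lambda>t. Ln (w t)) has_vector_derivative w' t / w t) (at t within {0..})"
proof -
  have "(Ln has_field_derivative inverse (w t)) (at (w t) within w ` {0..})"
    using m(1) m(2)[OF assms]
    by (intro has_field_derivative_at_within[OF has_field_derivative_Ln[OF Re_pos_notin_nonpos_Reals]]) simp
  from field_vector_diff_chain_within[OF deriv[OF assms] this]
  show ?thesis by (simp add: o_def divide_inverse)
qed

lemma Ln_deriv_le: "0 \<le> t \<Longrightarrow> cmod (w' t / w t) \<le> C / m * exp (- \<gamma> * t)"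
proof -
  assume t: "0 \<le> t"
  have "cmod (w' t / w t) \<le> C * exp (- \<gamma> * t) / m"
    unfolding norm_divide using m(1) decay[OF t] cmod_w_ge[OF t]
    by (intro frac_le order_trans[OF norm_ge_zero]) auto
  then show ?thesis by simp
qed

lemma phase_has_derivative:
  assumes "0 \<le> t"
  shows "(phase has_vector_derivative \<omega> + Im (w' t / w t)) (at t within {0..})"
proof -
  have d: "((\<lambda>t. \<omega> * t + Im (Ln (w t))) has_vector_derivative \<omega> + Im (w' t / w t)) (at t within {0..})"
    by (rule derivative_eq_intros bounded_linear.has_vector_derivative[OF bounded_linear_Im Ln_deriv[OF assms]]
        refl | simp)+
  have e: "phase s = \<omega> * s + Im (Ln (w s))" if "s \<in> {0..}" for s
    using w_nonzero[of s] that by (simp add: phase_def Arg_eq_Im_Ln)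
  show ?thesis
    by (rule has_vector_derivative_transform[OF _ e d]) (use assms in auto)
qed

lemma phase_unwraps: "unwrapped_angle z phase"
  unfolding unwrapped_angle_def
proof (intro conjI allI impI)
  show "continuous_on {0..} phase"
    using phase_has_derivative has_vector_derivative_continuous
    by (fastforce simp: continuous_on_eq_continuous_within)
  fix t :: real assume t: "0 \<le> t"
  have "z t = exp (\<i> * of_real (\<omega> * t)) * (of_real (cmod (w t)) * exp (\<i> * of_real (Arg (w t))))"
    by (rule arg_cong[OF Arg_eq[OF w_nonzero[OF t]]])
  also have "\<dots> = of_real (cmod (z t)) * exp (\<i> * of_real (phase t))"
    by (simp add: phase_def norm_mult distrib_left exp_add mult_ac)
  finally show "z t = of_real (cmod (z t)) * exp (\<i> * of_real (phase t))" .
qed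

text \<open>
  \<open>Ln w\<close> has the integrable derivative \<open>w' / w\<close>, so it converges at the same rate; its limit is \<open>Ln v\<close> by
  continuity.
\<close>

lemma phase_conv: "exp_tendsto (\<lambda>t. phase t - \<omega> * t) (Arg v)"
proof -
  obtain L where L: "\<And>t. 0 \<le> t \<Longrightarrow> cmod (Ln (w t) - L) \<le> C / m / \<gamma> * exp (- \<gamma> * t)"
    using exponential_tail_bound[OF Ln_deriv Ln_deriv_le \<gamma>] by blast
  have "(w \<longlongrightarrow> v) at_top"
    by (rule exp_tendsto_imp_tendsto, rule exp_tendstoI[OF _ \<gamma>, of _ _ C]) (simp add: dist_norm conv[simplified])
  then have lim_v: "((\<lambda>t. Ln (w t)) \<longlongrightarrow> Ln v) at_top"
    by (rule tendsto_Ln) (rule Re_pos_notin_nonpos_Reals[OF m(3)])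
  have lim_L: "((\<lambda>t. Ln (w t)) \<longlongrightarrow> L) at_top"
    by (rule exp_tendsto_imp_tendsto, rule exp_tendstoI[OF _ \<gamma>, of _ _ "C / m / \<gamma>"]) (simp add: dist_norm L[simplified])
  have "L = Ln v"
    by (rule tendsto_unique[OF trivial_limit_at_top_linorder lim_L lim_v])
  show ?thesis
  proof (rule exp_tendstoI[OF _ \<gamma>])
    fix t :: real assume t: "0 \<le> t"
    have "v \<noteq> 0" using m(3) by auto
    then have "phase t - \<omega> * t - Arg v = Im (Ln (w t) - L)"
      using w_nonzero[OF t] by (simp add: phase_def Arg_eq_Im_Ln \<open>L = Ln v\<close>)
    then show "dist (phase t - \<omega> * t) (Arg v) \<le> C / m / \<gamma> * exp (- \<gamma> * t)"
      using L[OF t] abs_Im_le_cmod[of "Ln (w t) - L"] by (simp add: dist_real_def)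
  qed
qed

lemma radius_has_derivative:
  assumes "0 \<le> t"
  shows "((\<lambda>t. cmod (z t)) has_vector_derivative w' t \<bullet> sgn (w t)) (at t within {0..})"
proof -
  have "(norm has_derivative (\<lambda>h. h \<bullet> sgn (w t))) (at (w t))"
    by (rule has_derivative_norm[OF w_nonzero[OF assms]])
  from has_derivative_compose[OF deriv[OF assms, unfolded has_vector_derivative_def] this]
  show ?thesis by (simp add: has_vector_derivative_def norm_mult)
qed

lemma radius_deriv_conv: "exp_tendsto (time_deriv (\<lambda>t. cmod (z t))) 0"
proof (rule exp_tendstoI[OF _ \<gamma>])
  fix t :: real assume t: "0 \<le> t"
  have "\<bar>w' t \<bullet> sgn (w t)\<bar> \<le> cmod (w' t)"
    using Cauchy_Schwarz_ineq2[of "w' t" "sgn (w t)"] w_nonzero[OF t] by (simp add: norm_sgn)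
  then show "dist (time_deriv (\<lambda>t. cmod (z t)) t) 0 \<le> C * exp (- \<gamma> * t)"
    unfolding time_deriv_eq[OF t radius_has_derivative[OF t]] using decay[OF t] by simp
qed

lemma radius_conv: "exp_tendsto (\<lambda>t. cmod (z t)) (cmod v)"
proof (rule exp_tendstoI[OF _ \<gamma>])
  fix t :: real assume t: "0 \<le> t"
  show "dist (cmod (z t)) (cmod v) \<le> C * exp (- \<gamma> * t)"
    using order_trans[OF norm_triangle_ineq3 conv[OF t]] by (simp add: norm_mult dist_real_def)
qed

text \<open>
  The angle is only assumed to agree with \<open>phase\<close> for nonnegative times, as nothing constrains an unwrapped
  angle at negative times.
\<close>

lemma phase_deriv_conv:
  assumes "\<And>t. 0 \<le> t \<Longrightarrow> \<theta> t = phase t"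
  shows "\<theta> differentiable_on {0..}" and "exp_tendsto (time_deriv \<theta>) \<omega>"
proof -
  have d: "(\<theta> has_vector_derivative \<omega> + Im (w' t / w t)) (at t within {0..})" if "0 \<le> t" for t
    by (rule has_vector_derivative_transform[OF _ _ phase_has_derivative[OF that]]) (use that assms in auto)
  then show "\<theta> differentiable_on {0..}"
    unfolding differentiable_on_def differentiable_def has_vector_derivative_def by auto
  show "exp_tendsto (time_deriv \<theta>) \<omega>"
  proof (rule exp_tendstoI[OF _ \<gamma>])
    fix t :: real assume t: "0 \<le> t"
    show "dist (time_deriv \<theta> t) \<omega> \<le> C / m * exp (- \<gamma> * t)"
      using order_trans[OF abs_Im_le_cmod Ln_deriv_le[OF t]]
      by (simp add: time_deriv_eq[OF t d[OF t]] dist_real_def)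
  qed
qed

lemma radius_differentiable: "(\<lambda>t. cmod (z t)) differentiable_on {0..}"
  using radius_has_derivative
  unfolding differentiable_on_def differentiable_def has_vector_derivative_def by auto

lemma curve_conv: "exp_tendsto (\<lambda>t. cmod (z t - of_real (cmod v) * exp (\<i> * of_real (\<omega> * t + Arg v)))) 0"
proof (rule exp_tendstoI[OF _ \<gamma>])
  fix t :: real assume t: "0 \<le> t"
  have "v \<noteq> 0" using m(3) by auto
  have "of_real (cmod v) * exp (\<i> * of_real (\<omega> * t + Arg v))
      = exp (\<i> * of_real (\<omega> * t)) * (of_real (cmod v) * exp (\<i> * of_real (Arg v)))"
    by (simp add: distrib_left exp_add mult_ac)
  also have "\<dots> = exp (\<i> * of_real (\<omega> * t)) * v"
    by (rule arg_cong[OF Arg_eq[OF \<open>v \<noteq> 0\<close>, symmetric]])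
  finally have "cmod (z t - of_real (cmod v) * exp (\<i> * of_real (\<omega> * t + Arg v))) = cmod (w t - v)"
    by (simp add: right_diff_distrib[symmetric] norm_mult)
  then show "dist (cmod (z t - of_real (cmod v) * exp (\<i> * of_real (\<omega> * t + Arg v)))) 0 \<le> C * exp (- \<gamma> * t)"
    using conv[OF t] by simp
qed

end

section \<open>Uniqueness and the network in rotating coordinates\<close>

lemma cubic_monotone:
  fixes v w :: "'v::real_inner"
  shows "0 \<le> (v - w) \<bullet> ((norm v)\<^sup>2 *\<^sub>R v - (norm w)\<^sup>2 *\<^sub>R w)"
proof -
  define A B I where "A = (norm v)\<^sup>2" and "B = (norm w)\<^sup>2" and "I = v \<bullet> w"
  have "0 \<le> (norm (v - w))\<^sup>2" by simp
  then have "2 * I \<le> A + B"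
    by (simp add: A_def B_def I_def power2_norm_eq_inner inner_diff_left inner_diff_right inner_commute)
  then have "(A + B) * (2 * I) \<le> (A + B) * (A + B)"
    by (intro mult_left_mono) (auto simp: A_def B_def)
  moreover have "0 \<le> (A - B)\<^sup>2" by simp
  moreover have "(v - w) \<bullet> ((norm v)\<^sup>2 *\<^sub>R v - (norm w)\<^sup>2 *\<^sub>R w) = A * A + B * B - (A + B) * I"
    by (simp add: A_def B_def I_def power2_norm_eq_inner inner_diff_left inner_diff_right inner_commute
        algebra_simps)
  ultimately show ?thesis by (simp add: power2_eq_square algebra_simps)
qed

context oscillator_network
begin

text \<open>
  The cubic damping is monotone and the coupling is negative semidefinite, so only the linear growth
  \<open>\<mu>\<close> can separate two states.
\<close>

lemma field_one_sided_Lipschitz: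
  "(\<Sum>l\<in>UNIV. (v l - w l) \<bullet> (field v l - field w l)) \<le> \<mu> * (\<Sum>l\<in>UNIV. (cmod (v l - w l))\<^sup>2)"
proof -
  define d where "d l = v l - w l" for l
  have "d l \<bullet> (field v l - field w l)
      \<le> \<mu> * (cmod (d l))\<^sup>2 + c * (\<Sum>k\<in>UNIV. a l k * ((d l - 0) \<bullet> (d k - d l)))" for l
  proof -
    define e where "e = (cmod (v l))\<^sup>2 *\<^sub>R v l - (cmod (w l))\<^sup>2 *\<^sub>R w l"
    define S where "S = (\<Sum>k\<in>UNIV. a l k *\<^sub>R (d k - d l))"
    have "S = (\<Sum>k\<in>UNIV. a l k *\<^sub>R (v k - v l)) - (\<Sum>k\<in>UNIV. a l k *\<^sub>R (w k - w l))"
      unfolding S_def sum_subtractf[symmetric]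
      by (intro sum.cong refl) (simp add: d_def algebra_simps)
    then have "field v l - field w l = \<mu> *\<^sub>R d l - e + c *\<^sub>R S"
      by (simp only: field_def d_def e_def) (simp add: algebra_simps)
    then have "d l \<bullet> (field v l - field w l) = \<mu> * (d l \<bullet> d l) - d l \<bullet> e + c * (d l \<bullet> S)"
      by (simp add: inner_add_right inner_diff_right)
    moreover have "0 \<le> d l \<bullet> e" unfolding d_def e_def by (rule cubic_monotone)
    moreover have "d l \<bullet> S = (\<Sum>k\<in>UNIV. a l k * ((d l - 0) \<bullet> (d k - d l)))"
      by (simp add: S_def inner_sum_right)
    ultimately show ?thesis by (simp add: power2_norm_eq_inner)
  qed
  then have "(\<Sum>l\<in>UNIV. d l \<bullet> (field v l - field w l))
      \<le> (\<Sum>l\<in>UNIV. \<mu> * (cmod (d l))\<^sup>2 + c * (\<Sum>k\<in>UNIV. a l k * ((d l - 0) \<bullet> (d k - d l))))"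
    by (rule sum_mono)
  also have "\<dots> = \<mu> * (\<Sum>l\<in>UNIV. (cmod (d l))\<^sup>2) + c * (- dirichlet_form d / 2)"
    by (simp only: sum.distrib sum_distrib_left[symmetric] sum_inner_differences)
  also have "\<dots> \<le> \<mu> * (\<Sum>l\<in>UNIV. (cmod (d l))\<^sup>2)"
    using c dirichlet_form_nonneg[of d] by simp
  finally show ?thesis by (simp add: d_def)
qed

lemma field_rotate:
  assumes "cmod e = 1"
  shows "field (\<lambda>k. e * u k) l = e * field u l"
proof -
  have "(\<Sum>k\<in>UNIV. a l k *\<^sub>R (e * u k - e * u l)) = e * (\<Sum>k\<in>UNIV. a l k *\<^sub>R (u k - u l))"
    unfolding sum_distrib_left by (intro sum.cong refl) (simp add: algebra_simps)
  then show ?thesis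
    by (simp add: field_def norm_mult assms distrib_left)
qed

end

lemma network_field_eq:
  assumes "oscillator_network (adj G) c \<mu>"
  shows "network_field G \<mu> \<omega> c w $ l
    = \<i> * of_real \<omega> * w $ l + oscillator_network.field (adj G) c \<mu> (\<lambda>k. w $ k) l"
proof -
  interpret oscillator_network "adj G" c \<mu> by fact
  show ?thesis
    by (simp only: network_field_def field_def scaleR_conv_of_real vec_lambda_beta)
      (simp add: distrib_right left_diff_distrib)
qed

text \<open>
  The rotation \<open>i \<omega>\<close> is skew and drops out of the inner product.
\<close>

lemma network_field_one_sided_Lipschitz:
  assumes "oscillator_network (adj G) c \<mu>"
  shows "(v - w) \<bullet> (network_field G \<mu> \<omega> c v - network_field G \<mu> \<omega> c w) \<le> \<mu> * (norm (v - w))\<^sup>2"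
proof -
  interpret oscillator_network "adj G" c \<mu> by fact
  have "(v - w) \<bullet> (network_field G \<mu> \<omega> c v - network_field G \<mu> \<omega> c w)
      = (\<Sum>l\<in>UNIV. (v $ l - w $ l) \<bullet> (field (\<lambda>k. v $ k) l - field (\<lambda>k. w $ k) l))"
    unfolding inner_vec_def
  proof (rule sum.cong[OF refl])
    fix l
    have "(v $ l - w $ l) \<bullet> (\<i> * of_real \<omega> * (v $ l - w $ l)) = 0"
      by (simp add: inner_complex_def)
    then show "(v - w) $ l \<bullet> (network_field G \<mu> \<omega> c v - network_field G \<mu> \<omega> c w) $ l
        = (v $ l - w $ l) \<bullet> (field (\<lambda>k. v $ k) l - field (\<lambda>k. w $ k) l)"
      by (simp add: network_field_eq[OF assms] right_diff_distrib inner_add_right inner_diff_right)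
  qed
  also have "\<dots> \<le> \<mu> * (\<Sum>l\<in>UNIV. (cmod (v $ l - w $ l))\<^sup>2)"
    by (rule field_one_sided_Lipschitz)
  also have "(\<Sum>l\<in>UNIV. (cmod (v $ l - w $ l))\<^sup>2) = (norm (v - w))\<^sup>2"
    by (simp add: power2_norm_eq_inner inner_vec_def)
  finally show ?thesis .
qed

lemma network_solution_unique:
  assumes osc: "oscillator_network (adj G) c \<mu>"
    and y: "network_solution G \<mu> \<omega> c J y" and z: "network_solution G \<mu> \<omega> c {0..} z"
    and J: "is_interval J" "0 \<in> J" "J \<subseteq> {0..}" and init: "y 0 = z 0" and t: "t \<in> J"
  shows "y t = z t"
proof -
  let ?F = "network_field G \<mu> \<omega> c"
  have t0: "0 \<le> t" using t J by auto
  have sub: "{0..t} \<subseteq> J"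
    by (rule subsetI) (rule mem_is_interval_1_I[OF J(1,2) t], auto)
  have "(norm (y t - z t))\<^sup>2 \<le> (norm (y 0 - z 0))\<^sup>2 * exp (2 * \<mu> * t)"
  proof (rule gronwall_differential[OF t0])
    fix s assume s: "s \<in> {0..t}"
    have "(y has_vector_derivative ?F (y s)) (at s within {0..t})"
      using y s sub unfolding network_solution_def
      by (intro has_vector_derivative_within_subset[OF _ sub]) blast
    moreover have "(z has_vector_derivative ?F (z s)) (at s within {0..t})"
      using z s unfolding network_solution_def
      by (intro has_vector_derivative_within_subset[of z _ s "{0..}" "{0..t}"]) auto
    ultimately show "((\<lambda>s. (norm (y s - z s))\<^sup>2) has_real_derivative
        2 * ((y s - z s) \<bullet> (?F (y s) - ?F (z s)))) (at s within {0..t})"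
      by (intro norm_square_has_real_derivative has_vector_derivative_diff)
    show "2 * ((y s - z s) \<bullet> (?F (y s) - ?F (z s))) \<le> 2 * \<mu> * (norm (y s - z s))\<^sup>2"
      using network_field_one_sided_Lipschitz[OF osc, of "y s" "z s" \<omega>] by simp
  qed
  then show ?thesis by (simp add: init)
qed

lemma has_vector_derivative_vecI:
  fixes f :: "real \<Rightarrow> 'a::real_normed_vector ^ 'n"
  assumes "\<And>l. ((\<lambda>t. f t $ l) has_vector_derivative f' $ l) (at t within S)"
  shows "(f has_vector_derivative f') (at t within S)"
  unfolding has_vector_derivative_def has_derivative_within
proof (intro conjI vec_tendstoI)
  fix l
  show "((\<lambda>y. ((1 / norm (y - t)) *\<^sub>R (f y - (f t + (y - t) *\<^sub>R f'))) $ l) \<longlongrightarrow> 0 $ l) (at t within S)"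
    using assms[of l] unfolding has_vector_derivative_def has_derivative_within by simp
qed (rule bounded_linear_scaleR_left)

text \<open>
  The field commutes with a common rotation of all components, hence a solution in the rotating frame
  turns into a solution with frequency \<open>\<omega>\<close>.
\<close>

lemma rotated_solution:
  assumes osc: "oscillator_network (adj G) c \<mu>"
    and u: "\<And>t l. 0 \<le> t \<Longrightarrow> ((\<lambda>s. u s $ l) has_vector_derivative
      oscillator_network.field (adj G) c \<mu> (\<lambda>k. u t $ k) l) (at t within {0..})"
  shows "network_solution G \<mu> \<omega> c {0..} (\<lambda>t. \<chi> l. exp (\<i> * of_real (\<omega> * t)) * u t $ l)"
  unfolding network_solution_def
proof (intro ballI has_vector_derivative_vecI)
  interpret oscillator_network "adj G" c \<mu> by fact
  fix t l assume "t \<in> {0::real..}"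
  then have t: "0 \<le> t" by simp
  define e where "e t = exp (\<i> * of_real (\<omega> * t))" for t
  have "(e has_vector_derivative \<i> * of_real \<omega> * e t) (at t within {0..})"
  proof -
    have "((\<lambda>x. exp (\<i> * of_real \<omega> * x)) has_field_derivative \<i> * of_real \<omega> * e t) (at (of_real t))"
      by (auto intro!: derivative_eq_intros simp: e_def mult.assoc)
    from has_vector_derivative_real_field[OF this]
    show ?thesis unfolding e_def by (simp add: mult.assoc)
  qed
  from has_vector_derivative_mult[OF this u[OF t, of l]]
  have "((\<lambda>s. e s * u s $ l) has_vector_derivative
      e t * field (\<lambda>k. u t $ k) l + \<i> * of_real \<omega> * e t * u t $ l) (at t within {0..})" .
  also have "e t * field (\<lambda>k. u t $ k) l = field (\<lambda>k. e t * u t $ k) l"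
    by (rule field_rotate[symmetric]) (simp add: e_def)
  finally show "((\<lambda>s. (\<chi> l. exp (\<i> * of_real (\<omega> * s)) * u s $ l) $ l) has_vector_derivative
      network_field G \<mu> \<omega> c (\<chi> l. exp (\<i> * of_real (\<omega> * t)) * u t $ l) $ l) (at t within {0..})"
    by (simp only: network_field_eq[OF osc] vec_lambda_beta e_def) (simp add: add.commute mult.assoc)
qed

lemma connected_pair_graph_oscillator_network:
  assumes "pair_graph G" and "pverts G = UNIV" and "Digraph_Component.connected (with_proj G)"
    and "0 < c" and "0 < \<mu>"
  shows "oscillator_network (adj G) c \<mu>"
proof -
  interpret G: pair_graph G by fact
  have sym: "(k, l) \<in> parcs G \<longleftrightarrow> (l, k) \<in> parcs G" for k l
    using G.arcs_symmetric by blast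
  have arcs: "{(l, k). 0 < adj G l k} = parcs G"
    by (auto simp: adj_def)
  have parcs: "parcs (mk_symmetric (with_proj G)) = parcs G"
    using sym by (auto simp: parcs_mk_symmetric)
  have "(j, l) \<in> (parcs G)\<^sup>*" for j l
  proof -
    have "reachable (with_proj (mk_symmetric (with_proj G))) j l"
      using assms(3) by (simp add: Digraph_Component.connected_def strongly_connected_def assms(2))
    then have "(j, l) \<in> rtrancl_on UNIV (parcs G)"
      by (simp add: reachable_def parcs assms(2))
    then show ?thesis by (rule rtrancl_on_rtranclI)
  qed
  then show ?thesis
    by unfold_locales (auto simp: arcs adj_def sym assms)
qed

section \<open>Synchronization\<close>

theorem theorem3p2:
  fixes G :: "'n::finite pair_pre_digraph"
    and c \<mu> \<omega> :: real
    and r\<^sub>0 \<theta>\<^sub>0 :: "'n \<Rightarrow> real"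
  assumes "pair_graph G" and "pverts G = UNIV" and "Digraph_Component.connected (with_proj G)"
    and "c > 0" and "\<mu> > 0"
    and "\<mu> > c * (MAX l. \<Sum>k\<in>UNIV. adj G l k)"
    and "\<And>l. r\<^sub>0 l > 0"
    and "\<And>l. 0 < \<theta>\<^sub>0 l" and "\<And>l. \<theta>\<^sub>0 l < pi / 2"
  shows "\<exists>z. network_solution G \<mu> \<omega> c {0..} z
     \<and> (\<forall>l. z 0 $ l = of_real (r\<^sub>0 l) * exp (\<i> * of_real (\<theta>\<^sub>0 l)))
     \<and> (\<forall>J y. is_interval J \<and> 0 \<in> J \<and> J \<subseteq> {0..} \<and> network_solution G \<mu> \<omega> c J y
          \<and> (\<forall>l. y 0 $ l = of_real (r\<^sub>0 l) * exp (\<i> * of_real (\<theta>\<^sub>0 l))) \<longrightarrow> (\<forall>t\<in>J. y t = z t))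
     \<and> (\<exists>\<theta>. \<forall>l. unwrapped_angle (\<lambda>t. z t $ l) (\<theta> l) \<and> \<theta> l 0 = \<theta>\<^sub>0 l)
     \<and> (\<exists>\<phi>. 0 < \<phi> \<and> \<phi> < pi / 2 \<and>
         (\<forall>\<theta>. (\<forall>l. unwrapped_angle (\<lambda>t. z t $ l) (\<theta> l) \<and> \<theta> l 0 = \<theta>\<^sub>0 l) \<longrightarrow>
            complete_sync z \<theta> \<and> exp_complete_sync z \<theta> \<and>
            (\<forall>l k.
               (radius z l \<longlongrightarrow> sqrt \<mu>) at_top
             \<and> ((\<lambda>t. \<bar>time_deriv (radius z l) t - time_deriv (radius z k) t\<bar>) \<longlongrightarrow> 0) at_top
             \<and> ((\<lambda>t. \<bar>time_deriv (\<theta> l) t - time_deriv (\<theta> k) t\<bar>) \<longlongrightarrow> 0) at_top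
             \<and> ((\<lambda>t. dist_S1 (\<theta> l t - \<omega> * t) \<phi>) \<longlongrightarrow> 0) at_top
             \<and> ((\<lambda>t. cmod (z t $ l - of_real (sqrt \<mu>) * exp (\<i> * of_real (\<omega> * t + \<phi>)))) \<longlongrightarrow> 0) at_top
             \<and> exp_tendsto (radius z l) (sqrt \<mu>)
             \<and> exp_tendsto (\<lambda>t. \<bar>time_deriv (radius z l) t - time_deriv (radius z k) t\<bar>) 0
             \<and> exp_tendsto (\<lambda>t. \<bar>time_deriv (\<theta> l) t - time_deriv (\<theta> k) t\<bar>) 0
             \<and> exp_tendsto (\<lambda>t. dist_S1 (\<theta> l t - \<omega> * t) \<phi>) 0
             \<and> exp_tendsto (\<lambda>t. cmod (z t $ l - of_real (sqrt \<mu>) * exp (\<i> * of_real (\<omega> * t + \<phi>)))) 0)))"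
proof -
  have osc: "oscillator_network (adj G) c \<mu>"
    by (rule connected_pair_graph_oscillator_network) fact+
  interpret oscillator_network "adj G" c \<mu> by (rule osc)
  define u\<^sub>0 where "u\<^sub>0 l = of_real (r\<^sub>0 l) * exp (\<i> * of_real (\<theta>\<^sub>0 l))" for l
  have "0 < Re (u\<^sub>0 l)" for l
    using assms(7,8,9)[of l] cos_gt_zero[of "\<theta>\<^sub>0 l"] by (simp add: u\<^sub>0_def Re_exp)
  moreover have "0 < Im (u\<^sub>0 l)" for l
    using assms(7,8,9)[of l] sin_gt_zero[of "\<theta>\<^sub>0 l"] by (simp add: u\<^sub>0_def Im_exp)
  ultimately obtain u m M q where u0: "\<And>l. u 0 $ l = u\<^sub>0 l"
    and du: "\<And>t l. 0 \<le> t \<Longrightarrow>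
      ((\<lambda>s. u s $ l) has_vector_derivative field (\<lambda>k. u t $ k) l) (at t within {0..})"
    and "0 < m" "0 < q"
    and region: "\<And>t l. 0 \<le> t \<Longrightarrow>
      m \<le> Re (u t $ l) \<and> cmod (u t $ l) \<le> M \<and> q * Re (u t $ l) \<le> Im (u t $ l)"
    by (rule global_solution_in_cone[of u\<^sub>0]) blast
  obtain v C \<gamma> where "\<gamma> > 0" and v: "cmod v = sqrt \<mu>"
    and speed: "\<And>t l. 0 \<le> t \<Longrightarrow> cmod (field (\<lambda>k. u t $ k) l) \<le> C * exp (- \<gamma> * t)"
    and conv: "\<And>t l. 0 \<le> t \<Longrightarrow> cmod (u t $ l - v) \<le> C * exp (- \<gamma> * t)"
    by (rule exponential_convergence[where u = "\<lambda>t k. u t $ k" and m = m and M = M])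
      (use du region \<open>0 < m\<close> in blast)+
  have lim: "((\<lambda>t. u t $ l) \<longlongrightarrow> v) at_top" for l
    by (rule exp_tendsto_imp_tendsto, rule exp_tendstoI[OF _ \<open>\<gamma> > 0\<close>, of _ _ C])
      (use conv in \<open>simp add: dist_norm\<close>)
  have ev: "\<forall>\<^sub>F t :: real in at_top. 0 \<le> t" by (rule eventually_ge_at_top)
  have "m \<le> Re v"
    by (rule tendsto_lowerbound[OF tendsto_Re[OF lim[of undefined]] eventually_mono[OF ev]])
      (use region in auto)
  then have Re_v: "0 < Re v" using \<open>0 < m\<close> by simp
  have "q * Re v \<le> Im v"
    by (rule tendsto_le[OF trivial_limit_at_top_linorder tendsto_Im[OF lim[of undefined]]
          tendsto_mult_left[OF tendsto_Re[OF lim[of undefined]]] eventually_mono[OF ev]])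
      (use region in blast)
  then have Im_v: "0 < Im v"
    using mult_pos_pos[OF \<open>0 < q\<close> Re_v] by linarith
  define \<phi> where "\<phi> = Arg v"
  have \<phi>: "0 < \<phi>" "\<phi> < pi / 2"
    using Re_v Im_v Arg_lt_pi[of v] Arg_Re_pos[of v] unfolding \<phi>_def by (auto simp: abs_if split: if_splits)
  define z where "z t = (\<chi> l. exp (\<i> * of_real (\<omega> * t)) * u t $ l)" for t
  have sol: "network_solution G \<mu> \<omega> c {0..} z"
    unfolding z_def[abs_def] by (rule rotated_solution[OF osc du])
  have z0: "z 0 $ l = of_real (r\<^sub>0 l) * exp (\<i> * of_real (\<theta>\<^sub>0 l))" for l
    by (simp add: z_def u0 u\<^sub>0_def)
  have unique: "y t = z t"
    if "is_interval J" "0 \<in> J" "J \<subseteq> {0..}" "network_solution G \<mu> \<omega> c J y"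
      "\<forall>l. y 0 $ l = of_real (r\<^sub>0 l) * exp (\<i> * of_real (\<theta>\<^sub>0 l))" "t \<in> J" for J y t
    by (rule network_solution_unique[OF osc that(4) sol that(1,2,3) _ that(6)])
      (simp add: vec_eq_iff that(5) z0)
  have curve: "rotating_convergent_curve (\<lambda>t. u t $ l) (\<lambda>t. field (\<lambda>k. u t $ k) l) v m C \<gamma>" for l
    by unfold_locales (use du speed conv region \<open>0 < m\<close> \<open>\<gamma> > 0\<close> Re_v in auto)
  define \<Theta> where "\<Theta> l = rotating_convergent_curve.phase (\<lambda>t. u t $ l) \<omega>" for l
  have z_l: "(\<lambda>t. z t $ l) = (\<lambda>t. exp (\<i> * of_real (\<omega> * t)) * u t $ l)" for l
    by (simp add: z_def)
  have \<Theta>: "unwrapped_angle (\<lambda>t. z t $ l) (\<Theta> l)" for l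
    unfolding z_l \<Theta>_def by (rule rotating_convergent_curve.phase_unwraps[OF curve])
  have \<Theta>0: "\<Theta> l 0 = \<theta>\<^sub>0 l" for l
  proof -
    have "Arg (u\<^sub>0 l) = \<theta>\<^sub>0 l"
      by (rule Arg_unique[of "r\<^sub>0 l"]) (use assms(7,8,9)[of l] in \<open>auto simp: u\<^sub>0_def\<close>)
    then show ?thesis
      by (simp add: \<Theta>_def rotating_convergent_curve.phase_def[OF curve] u0)
  qed
  have sync: "polar_phases z \<theta>"
    "exp_tendsto (radius z l) (sqrt \<mu>)"
    "exp_tendsto (\<lambda>t. \<bar>radius z l t - radius z k t\<bar>) 0"
    "exp_tendsto (\<lambda>t. \<bar>time_deriv (radius z l) t - time_deriv (radius z k) t\<bar>) 0"
    "exp_tendsto (\<lambda>t. \<bar>time_deriv (\<theta> l) t - time_deriv (\<theta> k) t\<bar>) 0"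
    "exp_tendsto (\<lambda>t. dist_S1 (\<theta> l t) (\<theta> k t)) 0"
    "exp_tendsto (\<lambda>t. dist_S1 (\<theta> l t - \<omega> * t) \<phi>) 0"
    "exp_tendsto (\<lambda>t. cmod (z t $ l - of_real (sqrt \<mu>) * exp (\<i> * of_real (\<omega> * t + \<phi>)))) 0"
    if \<theta>: "\<forall>l. unwrapped_angle (\<lambda>t. z t $ l) (\<theta> l) \<and> \<theta> l 0 = \<theta>\<^sub>0 l" for \<theta> l k
  proof -
    have pos: "0 < radius z l t" if "0 \<le> t" for l t
      using rotating_convergent_curve.w_nonzero[OF curve that, of l] by (simp add: z_def norm_mult)
    have eq: "\<theta> l t = \<Theta> l t" if "0 \<le> t" for l t
    proof (rule unwrapped_angle_unique[OF _ \<Theta> _ _ that])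
      show "unwrapped_angle (\<lambda>t. z t $ l) (\<theta> l)" and "\<theta> l 0 = \<Theta> l 0"
        using \<theta> \<Theta>0 by auto
      show "z s $ l \<noteq> 0" if "0 \<le> s" for s
        using pos[OF that, of l] by auto
    qed
    have r: "exp_tendsto (radius z l) (sqrt \<mu>)" for l
      using rotating_convergent_curve.radius_conv[OF curve[of l], of \<omega>] by (simp only: z_def vec_lambda_beta v)
    have dr: "exp_tendsto (time_deriv (radius z l)) 0" for l
      using rotating_convergent_curve.radius_deriv_conv[OF curve[of l], of \<omega>] by (simp only: z_def vec_lambda_beta)
    have d\<theta>: "\<theta> l differentiable_on {0..}" "exp_tendsto (time_deriv (\<theta> l)) \<omega>" for l
      using rotating_convergent_curve.phase_deriv_conv[OF curve eq[unfolded \<Theta>_def]] by auto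
    have ph: "exp_tendsto (\<lambda>t. \<theta> l t - \<omega> * t) \<phi>" for l
    proof -
      have "exp_tendsto (\<lambda>t. \<Theta> l t - \<omega> * t) \<phi>"
        unfolding \<Theta>_def \<phi>_def by (rule rotating_convergent_curve.phase_conv[OF curve])
      then show ?thesis by (simp add: exp_tendsto_def eq)
    qed
    show "exp_tendsto (radius z l) (sqrt \<mu>)" by (rule r)
    show "exp_tendsto (\<lambda>t. \<bar>radius z l t - radius z k t\<bar>) 0"
      by (rule exp_tendsto_abs_diff[OF r r])
    show "exp_tendsto (\<lambda>t. \<bar>time_deriv (radius z l) t - time_deriv (radius z k) t\<bar>) 0"
      by (rule exp_tendsto_abs_diff[OF dr dr])
    show "exp_tendsto (\<lambda>t. \<bar>time_deriv (\<theta> l) t - time_deriv (\<theta> k) t\<bar>) 0"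
      by (rule exp_tendsto_abs_diff[OF d\<theta>(2) d\<theta>(2)])
    show "exp_tendsto (\<lambda>t. dist_S1 (\<theta> l t) (\<theta> k t)) 0"
      by (rule exp_tendsto_dist_S1) (use exp_tendsto_abs_diff[OF ph[of l] ph[of k]] in simp)
    have "exp_tendsto (\<lambda>t. \<phi>) \<phi>"
      by (rule exp_tendstoI[of _ _ 0 1]) auto
    from exp_tendsto_dist_S1[OF exp_tendsto_abs_diff[OF ph this]]
    show "exp_tendsto (\<lambda>t. dist_S1 (\<theta> l t - \<omega> * t) \<phi>) 0" .
    show "exp_tendsto (\<lambda>t. cmod (z t $ l - of_real (sqrt \<mu>) * exp (\<i> * of_real (\<omega> * t + \<phi>)))) 0"
      using rotating_convergent_curve.curve_conv[OF curve[of l], of \<omega>] by (simp only: z_def vec_lambda_beta v \<phi>_def)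
    have "radius z l differentiable_on {0..}" for l
      using rotating_convergent_curve.radius_differentiable[OF curve[of l], of \<omega>] by (simp only: z_def vec_lambda_beta)
    then show "polar_phases z \<theta>"
      unfolding polar_phases_def using pos \<theta> d\<theta>(1) by blast
  qed
  show ?thesis
  proof (rule exI[of _ z], intro conjI)
    show "\<exists>\<phi>. 0 < \<phi> \<and> \<phi> < pi / 2 \<and>
         (\<forall>\<theta>. (\<forall>l. unwrapped_angle (\<lambda>t. z t $ l) (\<theta> l) \<and> \<theta> l 0 = \<theta>\<^sub>0 l) \<longrightarrow>
            complete_sync z \<theta> \<and> exp_complete_sync z \<theta> \<and>
            (\<forall>l k.
               (radius z l \<longlongrightarrow> sqrt \<mu>) at_top
             \<and> ((\<lambda>t. \<bar>time_deriv (radius z l) t - time_deriv (radius z k) t\<bar>) \<longlongrightarrow> 0) at_top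
             \<and> ((\<lambda>t. \<bar>time_deriv (\<theta> l) t - time_deriv (\<theta> k) t\<bar>) \<longlongrightarrow> 0) at_top
             \<and> ((\<lambda>t. dist_S1 (\<theta> l t - \<omega> * t) \<phi>) \<longlongrightarrow> 0) at_top
             \<and> ((\<lambda>t. cmod (z t $ l - of_real (sqrt \<mu>) * exp (\<i> * of_real (\<omega> * t + \<phi>)))) \<longlongrightarrow> 0) at_top
             \<and> exp_tendsto (radius z l) (sqrt \<mu>)
             \<and> exp_tendsto (\<lambda>t. \<bar>time_deriv (radius z l) t - time_deriv (radius z k) t\<bar>) 0
             \<and> exp_tendsto (\<lambda>t. \<bar>time_deriv (\<theta> l) t - time_deriv (\<theta> k) t\<bar>) 0
             \<and> exp_tendsto (\<lambda>t. dist_S1 (\<theta> l t - \<omega> * t) \<phi>) 0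
             \<and> exp_tendsto (\<lambda>t. cmod (z t $ l - of_real (sqrt \<mu>) * exp (\<i> * of_real (\<omega> * t + \<phi>)))) 0))"
      unfolding complete_sync_def exp_complete_sync_def
      by (intro exI[of _ \<phi>] conjI allI impI \<phi>)
        (assumption | rule sync exp_tendsto_imp_tendsto[OF sync(2)] exp_tendsto_imp_tendsto[OF sync(3)]
          exp_tendsto_imp_tendsto[OF sync(4)] exp_tendsto_imp_tendsto[OF sync(5)]
          exp_tendsto_imp_tendsto[OF sync(6)] exp_tendsto_imp_tendsto[OF sync(7)]
          exp_tendsto_imp_tendsto[OF sync(8)])+
  qed (use sol z0 unique \<Theta> \<Theta>0 in blast)+
qed

end
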